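(* Let $\Omega$ be a non-empty finite intersection of bounded strongly convex domains in $\mathbb{C}^n$. Then every complex geodesic $\psi:\mathbb{D}\to\Omega$ of $\Omega$ extends as a continuous map on $\overline{\mathbb{D}}$.
   Context: A bounded strongly convex domain is a bounded domain with $\mathcal{C}^2$-smooth boundary admitting a $\mathcal{C}^2$-smooth defining function whose real Hessian is positive definite on the (real) tangent space at each boundary point. $\mathbb{D}$ is the open unit disc in $\mathbb{C}$. A complex geodesic of $\Omega$ is a holomorphic map $\psi:\mathbb{D}\to\Omega$ that is an isometry for the Kobayashi distances on $\mathbb{D}$ and $\Omega$. *)

theory Defs
  imports "HOL-Analysis.Analysis"
begin

section \<open>Bounded strongly convex domains\<close>

text \<open>\<open>D\<close> and \<open>H\<close> are the first and the second Frechet derivative of \<open>r\<close> over the reals,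
  so that \<open>H x v w\<close> is the real Hessian form of \<open>r\<close> at \<open>x\<close>.\<close>

definition C2_with_derivs_on ::
  "('a::real_normed_vector \<Rightarrow> real) \<Rightarrow> ('a \<Rightarrow> 'a \<Rightarrow>\<^sub>L real) \<Rightarrow>
   ('a \<Rightarrow> 'a \<Rightarrow>\<^sub>L ('a \<Rightarrow>\<^sub>L real)) \<Rightarrow> 'a set \<Rightarrow> bool" where
  "C2_with_derivs_on r D H U \<longleftrightarrow>
     (\<forall>x\<in>U. (r has_derivative blinfun_apply (D x)) (at x)) \<and>
     (\<forall>x\<in>U. (D has_derivative blinfun_apply (H x)) (at x)) \<and>
     continuous_on U H"

text \<open>A defining function is only required on a neighbourhood \<open>U\<close> of the boundary. Its
  differential does not vanish on the boundary, where \<open>r = 0\<close> follows from continuity.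
  Having \<open>\<C>\<^sup>2\<close>-smooth boundary means that such a function exists.\<close>

definition C2_defining_function ::
  "('a::real_normed_vector) set \<Rightarrow> 'a set \<Rightarrow> ('a \<Rightarrow> real) \<Rightarrow> ('a \<Rightarrow> 'a \<Rightarrow>\<^sub>L real) \<Rightarrow>
   ('a \<Rightarrow> 'a \<Rightarrow>\<^sub>L ('a \<Rightarrow>\<^sub>L real)) \<Rightarrow> bool" where
  "C2_defining_function \<Omega> U r D H \<longleftrightarrow>
     open U \<and> frontier \<Omega> \<subseteq> U \<and> C2_with_derivs_on r D H U \<and>
     \<Omega> \<inter> U = {x \<in> U. r x < 0} \<and> (\<forall>p \<in> frontier \<Omega>. D p \<noteq> 0)"

text \<open>The real tangent space of the boundary at \<open>p\<close> is the kernel of \<open>D p\<close>.\<close>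

definition bounded_strongly_convex_domain :: "(complex ^ 'n) set \<Rightarrow> bool" where
  "bounded_strongly_convex_domain \<Omega> \<longleftrightarrow>
     open \<Omega> \<and> connected \<Omega> \<and> \<Omega> \<noteq> {} \<and> bounded \<Omega> \<and>
     (\<exists>U r D H. C2_defining_function \<Omega> U r D H \<and>
        (\<forall>p \<in> frontier \<Omega>. \<forall>v. v \<noteq> 0 \<and> D p v = 0 \<longrightarrow> H p v v > 0))"

section \<open>Kobayashi distance and complex geodesics\<close>

definition poincare_dist :: "complex \<Rightarrow> complex \<Rightarrow> real" where
  "poincare_dist \<zeta> \<xi> = artanh (cmod ((\<zeta> - \<xi>) / (1 - cnj \<xi> * \<zeta>)))"

text \<open>Kobayashi's definition by chains of holomorphic discs. The first argument is the set of all
  holomorphic maps from the unit disc into the space under consideration, which makes the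
  same definition available for domains in \<open>\<complex>\<close> and in \<open>\<complex>\<^sup>n\<close>. The infimum is
  meaningful when some chain joins the two points; on a connected domain this is always so.\<close>

definition kobayashi_dist_of_discs :: "(complex \<Rightarrow> 'a) set \<Rightarrow> 'a \<Rightarrow> 'a \<Rightarrow> real" where
  "kobayashi_dist_of_discs \<Phi> z w =
     Inf {\<Sum>i<m. poincare_dist (a i) (b i) | (m::nat) \<phi> a b p.
            p 0 = z \<and> p m = w \<and>
            (\<forall>i<m. \<phi> i \<in> \<Phi> \<and> a i \<in> ball 0 1 \<and> b i \<in> ball 0 1 \<and>
                   \<phi> i (a i) = p i \<and> \<phi> i (b i) = p (Suc i))}"

definition holomorphic_discs :: "(complex ^ 'n) set \<Rightarrow> (complex \<Rightarrow> complex ^ 'n) set" where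
  "holomorphic_discs \<Omega> =
     {\<phi>. (\<forall>j. (\<lambda>\<zeta>. \<phi> \<zeta> $ j) holomorphic_on ball 0 1) \<and> \<phi> ` ball 0 1 \<subseteq> \<Omega>}"

definition kobayashi_dist :: "(complex ^ 'n) set \<Rightarrow> complex ^ 'n \<Rightarrow> complex ^ 'n \<Rightarrow> real" where
  "kobayashi_dist \<Omega> = kobayashi_dist_of_discs (holomorphic_discs \<Omega>)"

definition kobayashi_dist_unit_disc :: "complex \<Rightarrow> complex \<Rightarrow> real" where
  "kobayashi_dist_unit_disc =
     kobayashi_dist_of_discs {\<phi>. \<phi> holomorphic_on ball 0 1 \<and> \<phi> ` ball 0 1 \<subseteq> ball 0 1}"

definition complex_geodesic :: "(complex ^ 'n) set \<Rightarrow> (complex \<Rightarrow> complex ^ 'n) \<Rightarrow> bool" where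
  "complex_geodesic \<Omega> \<psi> \<longleftrightarrow>
     \<psi> \<in> holomorphic_discs \<Omega> \<and>
     (\<forall>\<zeta> \<in> ball 0 1. \<forall>\<xi> \<in> ball 0 1.
        kobayashi_dist \<Omega> (\<psi> \<zeta>) (\<psi> \<xi>) = kobayashi_dist_unit_disc \<zeta> \<xi>)"

end

theory Submission
  imports Defs "HOL-Complex_Analysis.Riemann_Mapping"
begin

text \<open>Near a boundary point, a bounded strongly convex domain lies in a ball of fixed radius touching
  it there. Hence the derivative of a disc \<open>F\<close> in the domain at \<open>\<zeta>\<close> is at most a multiple of
  \<open>sqrt \<delta> / (1 - cmod \<zeta>)\<close>, where \<open>\<delta>\<close> is the boundary distance of \<open>F \<zeta>\<close>, and
  this passes to finite intersections. Strongly convex domains are convex, so the Kobayashi distance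
  of \<open>\<Omega>\<close> from a fixed point grows at most like \<open>ln (1 / \<delta>)\<close>, and for a complex geodesic
  \<open>\<delta>\<close> is therefore at most a multiple of a power of \<open>1 - cmod \<zeta>\<close>. The theorem of Hardy and
  Littlewood then applies to the components of the geodesic.\<close>

section \<open>Convexity and touching balls of strongly convex domains\<close>

text \<open>A finite intersection may have corners, so neither the smoothness nor the strong
  convexity of its members passes to \<open>\<Omega>\<close>; only convexity does. The square root
  reflects the touching ball: at distance \<delta> from a sphere of fixed radius, a tangential disc
  has room of order sqrt \<delta>. Boundedness alone yields 1 / (1 - cmod \<zeta>), whose integral
  along a radius just diverges. Any gain of a positive power of 1 - cmod \<zeta> makes it converge,
  so the constant in the logarithmic growth of the distance may be arbitrarily large; it affects
  only the exponent.\<close>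

lemma visible_from_point_open:
  fixes G :: "'a::euclidean_space set"
  assumes "open G"
  shows "open {y. closed_segment x y \<subseteq> G}"
  unfolding open_dist
proof
  fix y assume "y \<in> {y. closed_segment x y \<subseteq> G}"
  then have seg: "closed_segment x y \<subseteq> G" by simp
  obtain e where e: "0 < e" "{z. infdist z (closed_segment x y) \<le> e} \<subseteq> G"
    using compact_in_open_separated[of "closed_segment x y" G] seg assms by auto
  have "closed_segment x y' \<subseteq> G" if "dist y' y < e" for y'
  proof
    fix z assume "z \<in> closed_segment x y'"
    then obtain t where t: "0 \<le> t" "t \<le> 1" "z = (1 - t) *\<^sub>R x + t *\<^sub>R y'"
      by (auto simp: in_segment)
    let ?w = "(1 - t) *\<^sub>R x + t *\<^sub>R y"
    have w: "?w \<in> closed_segment x y" using t by (auto simp: in_segment)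
    have "z - ?w = t *\<^sub>R (y' - y)" by (simp add: t(3) scaleR_diff_right)
    then have "dist z ?w = t * dist y' y"
      using t(1) by (simp add: dist_norm)
    also have "\<dots> \<le> 1 * dist y' y"
      using t by (intro mult_right_mono) auto
    finally have "infdist z (closed_segment x y) \<le> e"
      using infdist_le2[OF w, of z e] that by auto
    then show "z \<in> G" using e by blast
  qed
  then show "\<exists>e>0. \<forall>y'. dist y' y < e \<longrightarrow> y' \<in> {y. closed_segment x y \<subseteq> G}"
    using e(1) by auto
qed

text \<open>Where the segment first leaves \<open>G\<close> it meets the frontier, at a point
  strictly between an earlier point, interior to the local convex piece, and a later point in the
  closure of that piece. Such a point is itself interior, a contradiction.\<close>

lemma segment_meeting_locally_convex_frontier:
  fixes G :: "'a::euclidean_space set"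
  assumes "open G"
    and loc: "\<And>p. p \<in> frontier G \<Longrightarrow> \<exists>e>0. convex (G \<inter> ball p e)"
    and xy: "x \<in> G" "y \<in> G" and seg: "closed_segment x y \<subseteq> closure G"
  shows "closed_segment x y \<subseteq> G"
proof (rule ccontr)
  assume nsub: "\<not> closed_segment x y \<subseteq> G"
  define \<gamma> where "\<gamma> t = (1 - t) *\<^sub>R x + t *\<^sub>R y" for t
  define T where "T = {t \<in> {0..1}. \<gamma> t \<notin> G}"
  have cont: "continuous_on A \<gamma>" for A unfolding \<gamma>_def by (intro continuous_intros)
  have "closed ({0..1} \<inter> \<gamma> -` (- G))"
    using assms(1) by (intro continuous_closed_preimage cont) auto
  moreover have T_eq: "T = {0..1} \<inter> \<gamma> -` (- G)" unfolding T_def by auto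
  ultimately have "closed T" by simp
  have "bdd_below T" unfolding T_def by (auto intro: bdd_belowI[of _ 0])
  have "T \<noteq> {}" using nsub unfolding T_def \<gamma>_def by (auto simp: in_segment)
  define t0 where "t0 = Inf T"
  have t0T: "t0 \<in> T" unfolding t0_def
    using closed_contains_Inf \<open>closed T\<close> \<open>bdd_below T\<close> \<open>T \<noteq> {}\<close> by blast
  have below: "\<gamma> s \<in> G" if "0 \<le> s" "s < t0" for s
  proof (rule ccontr)
    assume "\<gamma> s \<notin> G"
    then have "s \<in> T" using that t0T unfolding T_def by auto
    then show False
      using cInf_lower[OF _ \<open>bdd_below T\<close>, of s] that unfolding t0_def by auto
  qed
  have "t0 \<noteq> 0" "t0 \<noteq> 1" using t0T xy unfolding T_def \<gamma>_def by auto
  then have t0: "0 < t0" "t0 < 1" using t0T unfolding T_def by auto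
  have incl: "\<gamma> t \<in> closure G" if "0 \<le> t" "t \<le> 1" for t
    using that unfolding \<gamma>_def by (intro subsetD[OF seg]) (auto simp: in_segment)
  have "\<gamma> t0 \<in> frontier G"
    using t0T incl[of t0] t0 assms(1) unfolding T_def by (auto simp: frontier_def interior_open)
  then obtain e where e: "e > 0" "convex (G \<inter> ball (\<gamma> t0) e)" using loc by blast
  have "continuous (at t0) \<gamma>"
    using cont[of UNIV] by (simp add: continuous_on_eq_continuous_at)
  then obtain d where d: "d > 0" "\<And>t. \<bar>t - t0\<bar> < d \<Longrightarrow> dist (\<gamma> t) (\<gamma> t0) < e"
    unfolding continuous_at_eps_delta using e(1) by (auto simp: dist_real_def)
  \<comment> \<open>Equal steps to both sides make \<open>\<gamma> t0\<close> a midpoint; the bounds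
    keep the parameters in [0, 1] and the points in the ball.\<close>
  define h where "h = min (d / 2) (min t0 (1 - t0))"
  have h: "h > 0" "h < d" "h \<le> t0" "h \<le> 1 - t0" using d(1) t0 unfolding h_def by auto
  have "\<gamma> (t0 - h) \<in> G \<inter> ball (\<gamma> t0) e"
    using below[of "t0 - h"] d(2)[of "t0 - h"] h by (auto simp: dist_commute)
  then have a: "\<gamma> (t0 - h) \<in> interior (G \<inter> ball (\<gamma> t0) e)"
    using assms(1) by (simp add: interior_open open_Int)
  have "\<gamma> (t0 + h) \<in> closure G \<inter> ball (\<gamma> t0) e"
    using incl[of "t0 + h"] d(2)[of "t0 + h"] h t0 by (auto simp: dist_commute)
  then have b: "\<gamma> (t0 + h) \<in> closure (G \<inter> ball (\<gamma> t0) e)"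
    using open_Int_closure_subset[of "ball (\<gamma> t0) e" G] by (auto simp: Int_commute)
  have "x \<noteq> y" using nsub xy by auto
  then have "\<gamma> (t0 - h) \<noteq> \<gamma> (t0 + h)"
  proof -
    have "\<gamma> (t0 + h) - \<gamma> (t0 - h) = (2 * h) *\<^sub>R (y - x)"
      unfolding \<gamma>_def by (rule euclidean_eqI) (simp add: inner_simps algebra_simps)
    then show ?thesis using h(1) \<open>x \<noteq> y\<close> by auto
  qed
  moreover have "\<gamma> t0 = (1 - 1/2) *\<^sub>R \<gamma> (t0 - h) + (1/2) *\<^sub>R \<gamma> (t0 + h)"
    unfolding \<gamma>_def by (rule euclidean_eqI) (simp add: inner_simps algebra_simps)
  ultimately have "\<gamma> t0 \<in> open_segment (\<gamma> (t0 - h)) (\<gamma> (t0 + h))"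
    unfolding in_segment by (intro conjI exI[of _ "1/2"]) auto
  then have "\<gamma> t0 \<in> G"
    using in_interior_closure_convex_segment[OF e(2) a b] interior_subset by blast
  then show False using t0T unfolding T_def by auto
qed

text \<open>An open variant of the Tietze--Nakajima theorem: the points of \<open>G\<close> visible from a fixed
  \<open>x \<in> G\<close> form a relatively clopen set.\<close>

lemma convex_if_locally_convex_at_frontier:
  fixes G :: "'a::euclidean_space set"
  assumes "open G" "connected G"
    and loc: "\<And>p. p \<in> frontier G \<Longrightarrow> \<exists>e>0. convex (G \<inter> ball p e)"
  shows "convex G"
  unfolding convex_contains_segment
proof (intro ballI)
  fix x y assume x: "x \<in> G" and y: "y \<in> G"
  define A where "A = {y. closed_segment x y \<subseteq> G}"
  have "open A" unfolding A_def by (rule visible_from_point_open[OF assms(1)])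
  moreover have "A \<subseteq> G" unfolding A_def by auto
  moreover have "x \<in> A" unfolding A_def using x by auto
  moreover have "closedin (top_of_set G) A"
  proof -
    have "y \<in> A" if "y \<in> G" "y \<in> closure A" for y
    proof -
      obtain f where f: "\<And>n. f n \<in> A" "f \<longlonglongrightarrow> y"
        using \<open>y \<in> closure A\<close> unfolding closure_sequential by blast
      \<comment> \<open>A limit of visible points is at first visible only through
        \<open>closure G\<close>; the preceding lemma upgrades this to \<open>G\<close>.\<close>
      have "closed_segment x y \<subseteq> closure G"
      proof
        fix z assume "z \<in> closed_segment x y"
        then obtain t where t: "0 \<le> t" "t \<le> 1" "z = (1 - t) *\<^sub>R x + t *\<^sub>R y"
          by (auto simp: in_segment)
        have "(\<lambda>n. (1 - t) *\<^sub>R x + t *\<^sub>R f n) \<longlonglongrightarrow> z"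
          unfolding t(3) by (intro tendsto_intros f)
        moreover have "(1 - t) *\<^sub>R x + t *\<^sub>R f n \<in> G" for n
          using f(1)[of n] t unfolding A_def by (auto simp: in_segment subset_iff)
        ultimately show "z \<in> closure G" unfolding closure_sequential
          by (intro exI[of _ "\<lambda>n. (1 - t) *\<^sub>R x + t *\<^sub>R f n"]) simp
      qed
      then show "y \<in> A" unfolding A_def
        using segment_meeting_locally_convex_frontier[OF assms(1) loc x \<open>y \<in> G\<close>] by blast
    qed
    then have "A = G \<inter> closure A" using \<open>A \<subseteq> G\<close> closure_subset by blast
    then show ?thesis by (metis closed_closure closedin_closed_Int)
  qed
  ultimately have "A = G"
    using \<open>connected G\<close> unfolding connected_clopen
    by (metis empty_iff open_subset)
  then show "closed_segment x y \<subseteq> G" using y unfolding A_def by blast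
qed

section \<open>Strong convexity of an exponential of the defining function\<close>

text \<open>Unlike \<open>r\<close>, the function \<open>\<lambda>z. exp (l * r z)\<close> has for large \<open>l\<close> a Hessian
  that is positive definite in all directions.\<close>

lemma quadratic_form_positive_plus_square:
  fixes D :: "'a::euclidean_space \<Rightarrow>\<^sub>L real" and H :: "'a \<Rightarrow>\<^sub>L ('a \<Rightarrow>\<^sub>L real)"
  assumes pos: "\<And>v. v \<noteq> 0 \<Longrightarrow> D v = 0 \<Longrightarrow> H v v > 0"
  shows "\<exists>l>0. \<exists>c>0. \<forall>v. norm v = 1 \<longrightarrow> H v v + l * (D v)\<^sup>2 \<ge> c"
proof -
  define S :: "'a set" where "S = sphere 0 1"
  \<comment> \<open>\<open>F n v\<close> grows with \<open>n\<close>, so the sets where it is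
    positive form an increasing open cover of the compact unit sphere. \<open>Suc n\<close> keeps
    the multiplier positive for \<open>n = 0\<close>.\<close>
  define F where "F n v = H v v + real (Suc n) * (D v)\<^sup>2" for n v
  have contF: "continuous_on A (F n)" for A n
    unfolding F_def by (intro continuous_intros)
  have "S \<subseteq> (\<Union>n. {v. F n v > 0})"
  proof
    fix v assume "v \<in> S"
    then have "v \<noteq> 0" unfolding S_def by auto
    show "v \<in> (\<Union>n. {v. F n v > 0})"
    proof (cases "D v = 0")
      case True
      then show ?thesis using pos[OF \<open>v \<noteq> 0\<close>] unfolding F_def by auto
    next
      case False
      obtain n where n: "real n * (D v)\<^sup>2 > - H v v"
        using reals_Archimedean3[of "(D v)\<^sup>2"] False by auto
      have "real n * (D v)\<^sup>2 \<le> real (Suc n) * (D v)\<^sup>2" by (intro mult_right_mono) auto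
      then show ?thesis using n unfolding F_def by (intro UN_I[of n]) auto
    qed
  qed
  moreover have "open {v. F n v > 0}" for n
    by (intro open_Collect_less continuous_on_const contF)
  moreover have "compact S" unfolding S_def by simp
  ultimately obtain I where I: "finite I" "S \<subseteq> (\<Union>n\<in>I. {v. F n v > 0})"
    using compactE_image[of S UNIV "\<lambda>n. {v. F n v > 0}"] by (metis subset_UNIV)
  define N where "N = Max (insert 0 I)"
  have posN: "F N v > 0" if v: "v \<in> S" for v
  proof -
    obtain n where n: "n \<in> I" "F n v > 0" using I v by blast
    have "n \<le> N" unfolding N_def using n I by (intro Max_ge) auto
    then have "F n v \<le> F N v"
      unfolding F_def by (intro add_left_mono mult_right_mono) auto
    then show ?thesis using n by simp
  qed
  have "S \<noteq> {}" unfolding S_def by simp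
  then obtain v0 where v0: "v0 \<in> S" "\<And>v. v \<in> S \<Longrightarrow> F N v0 \<le> F N v"
    using continuous_attains_inf[OF \<open>compact S\<close> _ contF] by blast
  show ?thesis
    by (rule exI[of _ "real (Suc N)"], rule conjI, simp, rule exI[of _ "F N v0"])
      (use posN v0 in \<open>auto simp: S_def F_def\<close>)
qed

text \<open>The second derivative of \<open>exp (l * r x)\<close> in direction \<open>v\<close> is
  \<open>l * exp (l * r x)\<close> times \<open>H x v v + l * (D x v)\<^sup>2\<close>. A suitable
  \<open>l\<close> makes this form positive definite at \<open>p\<close>, continuity keeps it so on
  a ball, and integrating twice along a segment gives the quadratic gain. \<open>B\<close> will
  bound the vector that describes the touching ball.\<close>

lemma C2_exp_locally_strongly_convex:
  fixes r :: "'a::euclidean_space \<Rightarrow> real"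
  assumes C2: "C2_with_derivs_on r D H U" and U: "open U" "p \<in> U"
    and pos: "\<And>v. v \<noteq> 0 \<Longrightarrow> D p v = 0 \<Longrightarrow> H p v v > 0"
  obtains l e k B where "l > 0" "e > 0" "k > 0" "ball p e \<subseteq> U"
    "\<And>x. x \<in> ball p e \<Longrightarrow> norm (D x) \<le> B"
    "\<And>x y. \<lbrakk>x \<in> ball p e; y \<in> ball p e\<rbrakk> \<Longrightarrow>
       exp (l * r y) \<ge> exp (l * r x) + l * exp (l * r x) * D x (y - x) + k * (norm (y - x))\<^sup>2"
proof -
  have dr: "(r has_derivative D x) (at x)" and dD: "(D has_derivative H x) (at x)" if "x \<in> U" for x
    using C2 that unfolding C2_with_derivs_on_def by auto
  have contH: "continuous_on U H" using C2 unfolding C2_with_derivs_on_def by auto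
  have contr: "continuous_on U r"
    by (intro continuous_at_imp_continuous_on ballI has_derivative_continuous[OF dr])
  have contD: "continuous_on U D"
    by (intro continuous_at_imp_continuous_on ballI has_derivative_continuous[OF dD])
  have "\<exists>l>0. \<exists>c>0. \<forall>v. norm v = 1 \<longrightarrow> H p v v + l * (D p v)\<^sup>2 \<ge> c"
    by (rule quadratic_form_positive_plus_square[OF pos])
  then obtain l c where lc: "l > 0" "c > 0" "\<forall>v. norm v = 1 \<longrightarrow> H p v v + l * (D p v)\<^sup>2 \<ge> c"
    by (elim exE conjE)
  \<comment> \<open>\<open>N x\<close> bounds, on unit vectors, how far the form can drop between
    \<open>p\<close> and \<open>x\<close>; the set \<open>W\<close> permits a drop of half of
    \<open>c\<close>.\<close>
  define N where "N x = norm (H x - H p) + l * (norm (D x - D p) * (norm (D x) + norm (D p)))" for x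
  define c0 where "c0 = exp (l * r p) / 2"
  define W where "W = U \<inter> {x. N x < c / 2 \<and> norm (D x) < norm (D p) + 1 \<and> exp (l * r x) > c0}"
  have sub: "open (U \<inter> f -` {..<b})" if "continuous_on U f" for f :: "'a \<Rightarrow> real" and b
    by (rule continuous_open_preimage[OF that U(1) open_lessThan])
  have "open ((U \<inter> N -` {..<c / 2}) \<inter> (U \<inter> (\<lambda>x. norm (D x)) -` {..<norm (D p) + 1}) \<inter>
       (U \<inter> (\<lambda>x. - exp (l * r x)) -` {..<- c0}))"
    unfolding N_def by (intro open_Int sub continuous_intros contH contD contr)
  also have "\<dots> = W" unfolding W_def by auto
  finally have "open W" .
  moreover have "p \<in> W" unfolding W_def N_def c0_def using U(2) lc by auto
  ultimately obtain e where e: "e > 0" "ball p e \<subseteq> W" by (meson openE)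
  \<comment> \<open>Half the lower bound \<open>l * c0 * (c / 2)\<close> of the second derivative,
    as in Taylor's formula.\<close>
  define k where "k = l * c0 * (c / 2) / 2"
  have "c0 > 0" unfolding c0_def by simp
  then have "k > 0" unfolding k_def using lc by simp
  have hess: "H x v v + l * (D x v)\<^sup>2 \<ge> c / 2 * (norm v)\<^sup>2" if x: "x \<in> ball p e" for x v
  proof -
    have unit: "H x v v + l * (D x v)\<^sup>2 \<ge> c / 2" if v: "norm v = 1" for v
    proof -
      have "H p v v - H x v v = - ((H x - H p) v v)" by (simp add: blinfun.diff_left)
      also have "\<dots> \<le> norm ((H x - H p) v v)" by simp
      also have "\<dots> \<le> norm ((H x - H p) v) * norm v" by (rule norm_blinfun)
      also have "\<dots> \<le> norm (H x - H p)" using norm_blinfun[of "H x - H p" v] v by simp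
      finally have 1: "H p v v - H x v v \<le> norm (H x - H p)" .
      have "(D p v)\<^sup>2 - (D x v)\<^sup>2 = - (D x - D p) v * (D x v + D p v)"
        by (simp add: blinfun.diff_left power2_eq_square algebra_simps blinfun.minus_left)
      also have "\<dots> \<le> \<bar>(D x - D p) v * (D x v + D p v)\<bar>"
        by (simp add: blinfun.minus_left)
      also have "\<dots> \<le> norm (D x - D p) * (norm (D x) + norm (D p))"
        unfolding abs_mult
        using norm_blinfun[of "D x - D p" v] norm_blinfun[of "D x" v] norm_blinfun[of "D p" v] v
        by (intro mult_mono) auto
      finally have "l * ((D p v)\<^sup>2 - (D x v)\<^sup>2) \<le> l * (norm (D x - D p) * (norm (D x) + norm (D p)))"
        using lc(1) by (intro mult_left_mono) auto
      moreover have "N x < c / 2" using x e unfolding W_def by auto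
      ultimately show ?thesis using 1 lc(3)[rule_format, OF v] unfolding N_def by (simp add: algebra_simps)
    qed
    show ?thesis
    proof (cases "v = 0")
      case False
      define u where "u = v /\<^sub>R norm v"
      have u: "norm u = 1" "v = norm v *\<^sub>R u" unfolding u_def using False by auto
      have "H x v v + l * (D x v)\<^sup>2 = (H x u u + l * (D x u)\<^sup>2) * (norm v)\<^sup>2"
        unfolding u_def using False
        by (simp add: blinfun.scaleR_right blinfun.scaleR_left power2_eq_square field_simps)
      then show ?thesis using mult_right_mono[OF unit[OF u(1)], of "(norm v)\<^sup>2"] by simp
    qed simp
  qed
  have main: "exp (l * r y) \<ge> exp (l * r x) + l * exp (l * r x) * D x (y - x) + k * (norm (y - x))\<^sup>2"
    if x: "x \<in> ball p e" and y: "y \<in> ball p e" for x y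
  proof -
    define v where "v = y - x"
    define \<gamma> where "\<gamma> t = x + t *\<^sub>R v" for t
    have \<gamma>: "\<gamma> t \<in> ball p e" if "0 \<le> t" "t \<le> 1" for t
    proof -
      have "\<gamma> t = (1 - t) *\<^sub>R x + t *\<^sub>R y" unfolding \<gamma>_def v_def by (simp add: algebra_simps)
      then show ?thesis
        using convexD_alt[OF convex_ball x y, of t] that by simp
    qed
    then have \<gamma>U: "\<gamma> t \<in> U" if "0 \<le> t" "t \<le> 1" for t
      using e that unfolding W_def by blast
    have d\<gamma>: "(\<gamma> has_derivative (\<lambda>s. s *\<^sub>R v)) (at t)" for t
      unfolding \<gamma>_def by (auto intro!: derivative_eq_intros)
    have g1: "((\<lambda>t. r (\<gamma> t)) has_real_derivative D (\<gamma> t) v) (at t)" if "0 \<le> t" "t \<le> 1" for t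
      using has_derivative_compose[OF d\<gamma> dr[OF \<gamma>U[OF that]]]
      unfolding has_field_derivative_def by (simp add: blinfun.scaleR_right mult_commute_abs)
    have g2: "((\<lambda>t. D (\<gamma> t) v) has_real_derivative H (\<gamma> t) v v) (at t)" if "0 \<le> t" "t \<le> 1" for t
    proof -
      have "((\<lambda>t. D (\<gamma> t)) has_derivative (\<lambda>s. H (\<gamma> t) (s *\<^sub>R v))) (at t)"
        using has_derivative_compose[OF d\<gamma> dD[OF \<gamma>U[OF that]]] .
      then have "((\<lambda>t. D (\<gamma> t) v) has_derivative (\<lambda>s. H (\<gamma> t) (s *\<^sub>R v) v)) (at t)"
        by (auto intro!: derivative_eq_intros)
      then show ?thesis
        unfolding has_field_derivative_def
        by (simp add: blinfun.scaleR_right blinfun.scaleR_left mult_commute_abs)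
    qed
    define E where "E t = exp (l * r (\<gamma> t))" for t
    define E1 where "E1 t = l * E t * D (\<gamma> t) v" for t
    have dE: "(E has_real_derivative E1 t) (at t)" if "0 \<le> t" "t \<le> 1" for t
      unfolding E_def E1_def by (rule derivative_eq_intros g1[OF that] refl)+ simp
    have dE1: "(E1 has_real_derivative l * E t * (H (\<gamma> t) v v + l * (D (\<gamma> t) v)\<^sup>2)) (at t)"
      if "0 \<le> t" "t \<le> 1" for t
      unfolding E1_def[abs_def]
      by (rule derivative_eq_intros dE[OF that] g2[OF that] refl)+
        (simp add: E1_def algebra_simps power2_eq_square)
    have E2: "l * E t * (H (\<gamma> t) v v + l * (D (\<gamma> t) v)\<^sup>2) \<ge> 2 * k * (norm v)\<^sup>2" if "0 \<le> t" "t \<le> 1" for t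
    proof -
      have "E t \<ge> c0" using \<gamma>[OF that] e unfolding W_def E_def by auto
      then have "l * c0 * (c / 2 * (norm v)\<^sup>2) \<le> l * E t * (H (\<gamma> t) v v + l * (D (\<gamma> t) v)\<^sup>2)"
        using lc \<open>c0 > 0\<close> hess[OF \<gamma>[OF that], of v]
        by (intro mult_mono mult_left_mono) auto
      then show ?thesis unfolding k_def by (simp add: algebra_simps)
    qed
    \<comment> \<open>Taylor's bound by monotonicity used twice: here for the first derivative,
      below for the function itself.\<close>
    have slope: "E1 t - E1 0 - 2 * k * (norm v)\<^sup>2 * t \<ge> 0" if "0 \<le> t" "t \<le> 1" for t
    proof -
      have "E1 0 - 2 * k * (norm v)\<^sup>2 * 0 \<le> E1 t - 2 * k * (norm v)\<^sup>2 * t"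
      proof (rule DERIV_nonneg_imp_nondecreasing[OF that(1)])
        fix s assume "0 \<le> s" "s \<le> t"
        then have s: "0 \<le> s" "s \<le> 1" using that by auto
        have "((\<lambda>t. E1 t - 2 * k * (norm v)\<^sup>2 * t) has_real_derivative
          l * E s * (H (\<gamma> s) v v + l * (D (\<gamma> s) v)\<^sup>2) - 2 * k * (norm v)\<^sup>2) (at s)"
          by (rule derivative_eq_intros dE1[OF s] refl)+ simp
        then show "\<exists>y. ((\<lambda>t. E1 t - 2 * k * (norm v)\<^sup>2 * t) has_real_derivative y) (at s) \<and> 0 \<le> y"
          using E2[OF s] by (intro exI conjI) auto
      qed
      then show ?thesis by simp
    qed
    have "E 0 - E1 0 * 0 - k * (norm v)\<^sup>2 * 0\<^sup>2 \<le> E 1 - E1 0 * 1 - k * (norm v)\<^sup>2 * 1\<^sup>2"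
    proof (rule DERIV_nonneg_imp_nondecreasing[of 0 1 "\<lambda>t. E t - E1 0 * t - k * (norm v)\<^sup>2 * t\<^sup>2"])
      fix s :: real assume s: "0 \<le> s" "s \<le> 1"
      have "((\<lambda>t. E t - E1 0 * t - k * (norm v)\<^sup>2 * t\<^sup>2) has_real_derivative
          E1 s - E1 0 - 2 * k * (norm v)\<^sup>2 * s) (at s)"
        by (rule derivative_eq_intros dE[OF s] refl)+ simp
      then show "\<exists>y. ((\<lambda>t. E t - E1 0 * t - k * (norm v)\<^sup>2 * t\<^sup>2) has_real_derivative y) (at s) \<and> 0 \<le> y"
        using slope[OF s] by (intro exI conjI) auto
    qed simp
    then show ?thesis unfolding E1_def E_def \<gamma>_def v_def by simp
  qed
  show thesis
  proof (rule that[of l e k "norm (D p) + 1"])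
    show "ball p e \<subseteq> U" using e(2) unfolding W_def by blast
    show "norm (D x) \<le> norm (D p) + 1" if "x \<in> ball p e" for x
      using e(2) that unfolding W_def by fastforce
  qed (use lc e \<open>k > 0\<close> main in simp_all)
qed

section \<open>Touching balls at boundary points\<close>

lemma defining_function_eq_0_on_frontier:
  assumes "open \<Omega>" and def: "C2_defining_function \<Omega> U r D H" and p: "p \<in> frontier \<Omega>"
  shows "r p = 0"
proof -
  have U: "open U" "p \<in> U" "\<Omega> \<inter> U = {x \<in> U. r x < 0}"
    and "(r has_derivative D p) (at p)"
    using def p unfolding C2_defining_function_def C2_with_derivs_on_def by auto
  then have "continuous (at p) r" by (meson has_derivative_continuous)
  have "p \<in> closure \<Omega>" "p \<notin> \<Omega>"
    using p assms(1) by (auto simp: frontier_def interior_open)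
  then have "r p \<ge> 0" using U by fastforce
  moreover have "\<not> r p > 0"
  proof
    assume "r p > 0"
    then have "eventually (\<lambda>x. r x > 0) (nhds p)"
      using \<open>continuous (at p) r\<close> order_tendstoD(1)[of r "r p" "nhds p" 0]
      unfolding continuous_at tendsto_at_iff_tendsto_nhds by simp
    then obtain S where S: "open S" "p \<in> S" "\<And>x. x \<in> S \<Longrightarrow> r x > 0"
      unfolding eventually_nhds by blast
    have "(S \<inter> U) \<inter> \<Omega> \<noteq> {}"
      using \<open>p \<in> closure \<Omega>\<close> S U open_Int_closure_eq_empty[of "S \<inter> U" \<Omega>] by blast
    then obtain x where "x \<in> S" "x \<in> \<Omega> \<inter> U" by auto
    then show False using S(3)[of x] U(3) by auto
  qed
  ultimately show ?thesis by simp
qed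

lemma representing_vector:
  fixes D :: "'a::euclidean_space \<Rightarrow>\<^sub>L real"
  obtains d where "\<And>v. D v = d \<bullet> v" "norm d \<le> norm D"
proof -
  define d where "d = adjoint D 1"
  have d: "D v = d \<bullet> v" for v
    using adjoint_works[OF bounded_linear.linear[OF blinfun.bounded_linear_right[of D]], of v 1] unfolding d_def
    by (simp add: inner_commute)
  have "norm d * norm d = D d" by (simp add: d norm_eq_sqrt_inner)
  also have "\<dots> \<le> norm D * norm d" using norm_blinfun[of D d] by simp
  finally have "norm d \<le> norm D"
    by (cases "d = 0") auto
  then show ?thesis using d that by blast
qed

text \<open>After division by its quadratic coefficient, the lower bound of the strongly convex defining
  function says that near \<open>p\<close> the domain lies in a Euclidean ball with \<open>p\<close> on its boundary.\<close>

lemma bounded_strongly_convex_domain_local: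
  assumes G: "bounded_strongly_convex_domain G" and p0: "p0 \<in> frontier G"
  shows "\<exists>e>0. convex (G \<inter> ball p0 e) \<and>
    (\<forall>p\<in>frontier G \<inter> ball p0 e. \<exists>d. norm d \<le> 1 / e \<and>
       (\<forall>z\<in>G \<inter> ball p0 e. d \<bullet> (z - p) + (norm (z - p))\<^sup>2 \<le> 0))"
proof -
  obtain U r D H where opn: "open G" and def: "C2_defining_function G U r D H"
    and pos: "\<And>v. v \<noteq> 0 \<Longrightarrow> D p0 v = 0 \<Longrightarrow> H p0 v v > 0"
    using G p0 unfolding bounded_strongly_convex_domain_def by blast
  have U: "open U" "p0 \<in> U" and C2: "C2_with_derivs_on r D H U"
    and GU: "G \<inter> U = {x \<in> U. r x < 0}"
    using def p0 unfolding C2_defining_function_def by auto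
  obtain l e k B where lek: "l > 0" "e > 0" "k > 0" "ball p0 e \<subseteq> U"
    and B: "\<And>x. x \<in> ball p0 e \<Longrightarrow> norm (D x) \<le> B"
    and ineq: "\<And>x y. \<lbrakk>x \<in> ball p0 e; y \<in> ball p0 e\<rbrakk> \<Longrightarrow>
       exp (l * r y) \<ge> exp (l * r x) + l * exp (l * r x) * D x (y - x) + k * (norm (y - x))\<^sup>2"
    using C2_exp_locally_strongly_convex[OF C2 U pos] by metis
  have inG: "x \<in> G \<longleftrightarrow> exp (l * r x) < 1" if "x \<in> ball p0 e" for x
  proof -
    have "x \<in> G \<longleftrightarrow> r x < 0" using that GU lek(4) by blast
    also have "\<dots> \<longleftrightarrow> exp (l * r x) < 1" using lek(1) by (simp add: mult_less_0_iff)
    finally show ?thesis .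
  qed
  have "B \<ge> 0" using order_trans[OF norm_ge_zero B, of p0] lek(2) by simp
  have conv: "convex (G \<inter> ball p0 e')" if "e' \<le> e" for e'
    unfolding convex_alt
  proof (intro ballI allI impI)
    fix x y and t :: real
    assume x: "x \<in> G \<inter> ball p0 e'" and y: "y \<in> G \<inter> ball p0 e'" and t: "0 \<le> t \<and> t \<le> 1"
    define m where "m = (1 - t) *\<^sub>R x + t *\<^sub>R y"
    have m: "m \<in> ball p0 e'"
      using convexD_alt[OF convex_ball, of x p0 e' y t] x y t unfolding m_def by auto
    then have inb: "x \<in> ball p0 e" "y \<in> ball p0 e" "m \<in> ball p0 e" using x y that by auto
    \<comment> \<open>The linear terms of the lower bounds based at \<open>m\<close> cancel in the
      convex combination, which leaves \<open>exp (l * r m) < 1\<close>.\<close>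
    have lin: "(1 - t) * D m (x - m) + t * D m (y - m) = 0"
    proof -
      have "(1 - t) * D m (x - m) + t * D m (y - m) = D m ((1 - t) *\<^sub>R (x - m) + t *\<^sub>R (y - m))"
        by (simp add: blinfun.add_right blinfun.scaleR_right)
      also have "(1 - t) *\<^sub>R (x - m) + t *\<^sub>R (y - m) = 0"
        unfolding m_def by (simp add: algebra_simps)
      finally show ?thesis by simp
    qed
    define E where "E = exp (l * r m)"
    have "exp (l * r x) \<ge> E + l * E * D m (x - m)" "exp (l * r y) \<ge> E + l * E * D m (y - m)"
      using ineq[OF inb(3,1)] ineq[OF inb(3,2)] lek(3) unfolding E_def
      by (smt (verit) mult_nonneg_nonneg zero_le_power2)+
    then have "(1 - t) * (E + l * E * D m (x - m)) + t * (E + l * E * D m (y - m))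
        \<le> (1 - t) * exp (l * r x) + t * exp (l * r y)"
      using t by (intro add_mono mult_left_mono) auto
    also have "(1 - t) * (E + l * E * D m (x - m)) + t * (E + l * E * D m (y - m))
        = E + l * E * ((1 - t) * D m (x - m) + t * D m (y - m))"
      by (simp add: algebra_simps)
    also have "\<dots> = E" by (simp add: lin)
    also have "(1 - t) * exp (l * r x) + t * exp (l * r y) < 1"
      using x y t inG inb by (intro convex_bound_lt) auto
    finally have "m \<in> G" unfolding E_def using inG[OF inb(3)] by simp
    then show "(1 - t) *\<^sub>R x + t *\<^sub>R y \<in> G \<inter> ball p0 e'" using m unfolding m_def by simp
  qed
  have supp: "\<exists>d. norm d \<le> l * B / k \<and>
      (\<forall>z\<in>G \<inter> ball p0 e. d \<bullet> (z - p) + (norm (z - p))\<^sup>2 \<le> 0)"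
    if p: "p \<in> frontier G \<inter> ball p0 e" for p
  proof -
    obtain d0 where d0: "\<And>v. D p v = d0 \<bullet> v" "norm d0 \<le> norm (D p)"
      using representing_vector by blast
    have "r p = 0" using defining_function_eq_0_on_frontier[OF opn def] p by blast
    have "((l / k) *\<^sub>R d0) \<bullet> (z - p) + (norm (z - p))\<^sup>2 \<le> 0" if z: "z \<in> G \<inter> ball p0 e" for z
    proof -
      have "1 + l * (d0 \<bullet> (z - p)) + k * (norm (z - p))\<^sup>2 \<le> exp (l * r z)"
        using ineq[of p z] p z by (simp add: \<open>r p = 0\<close> d0(1))
      also have "\<dots> < 1" using inG z by auto
      finally show ?thesis using lek(3) by (simp add: field_simps)
    qed
    moreover have "norm ((l / k) *\<^sub>R d0) \<le> l * B / k"
      using lek d0(2) B[of p] p by (simp add: divide_right_mono)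
    ultimately show ?thesis by blast
  qed
  \<comment> \<open>One number has to serve both as radius and, inverted, as bound for
    \<open>norm d\<close>.\<close>
  define e' where "e' = min e (1 / (l * B / k + 1))"
  have lB: "l * B / k \<ge> 0" using lek \<open>B \<ge> 0\<close> by simp
  then have e': "e' > 0" "e' \<le> e" using lek(2) unfolding e'_def by auto
  have "e' \<le> 1 / (l * B / k + 1)" unfolding e'_def by simp
  then have "l * B / k + 1 \<le> 1 / e'" using e'(1) lB by (simp add: field_simps)
  then have "l * B / k \<le> 1 / e'" by simp
  show ?thesis
  proof (intro exI[of _ e'] conjI ballI)
    fix p assume "p \<in> frontier G \<inter> ball p0 e'"
    then obtain d where "norm d \<le> l * B / k"
        "\<forall>z\<in>G \<inter> ball p0 e. d \<bullet> (z - p) + (norm (z - p))\<^sup>2 \<le> 0"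
      using supp[of p] e'(2) by auto
    then show "\<exists>d. norm d \<le> 1 / e' \<and> (\<forall>z\<in>G \<inter> ball p0 e'. d \<bullet> (z - p) + (norm (z - p))\<^sup>2 \<le> 0)"
      using \<open>l * B / k \<le> 1 / e'\<close> e'(2) by (intro exI[of _ d]) auto
  qed (use e' conv in auto)
qed

lemma bounded_strongly_convex_domain_imp_convex:
  assumes "bounded_strongly_convex_domain G"
  shows "convex G"
proof (rule convex_if_locally_convex_at_frontier)
  show "open G" "connected G" using assms unfolding bounded_strongly_convex_domain_def by auto
  show "\<exists>e>0. convex (G \<inter> ball p e)" if "p \<in> frontier G" for p
    using bounded_strongly_convex_domain_local[OF assms that] by blast
qed

text \<open>The frontier is compact, so finitely many balls of half the local radius cover it; about
  a point of such a half ball, a ball of the other half radius still lies in the local ball.\<close>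

lemma bounded_strongly_convex_domain_uniform:
  assumes G: "bounded_strongly_convex_domain G"
  shows "\<exists>e>0. \<forall>p\<in>frontier G. \<exists>d. norm d \<le> 1 / e \<and>
       (\<forall>z\<in>G \<inter> ball p e. d \<bullet> (z - p) + (norm (z - p))\<^sup>2 \<le> 0)"
proof -
  obtain e where e: "\<And>p0. p0 \<in> frontier G \<Longrightarrow> e p0 > 0 \<and>
    (\<forall>p\<in>frontier G \<inter> ball p0 (e p0). \<exists>d. norm d \<le> 1 / e p0 \<and>
       (\<forall>z\<in>G \<inter> ball p0 (e p0). d \<bullet> (z - p) + (norm (z - p))\<^sup>2 \<le> 0))"
    using bounded_strongly_convex_domain_local[OF G] by metis
  have cpt: "compact (frontier G)"
    using G unfolding bounded_strongly_convex_domain_def by (intro compact_frontier_bounded) auto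
  have cover: "frontier G \<subseteq> (\<Union>p\<in>frontier G. ball p (e p / 2))" using e by force
  obtain I where I: "I \<subseteq> frontier G" "finite I" "frontier G \<subseteq> (\<Union>p\<in>I. ball p (e p / 2))"
    by (rule compactE_image[OF cpt open_ball cover])
  define e0 where "e0 = Min (insert 1 ((\<lambda>p. e p / 2) ` I))"
  have e0: "e0 > 0"
    unfolding e0_def using I(1,2) e by auto
  have e0_le: "\<And>p. p \<in> I \<Longrightarrow> e0 \<le> e p / 2"
    unfolding e0_def using I(2) by (intro Min_le) auto
  show ?thesis
  proof (intro exI[of _ e0] conjI ballI)
    fix p assume p: "p \<in> frontier G"
    then obtain p0 where p0: "p0 \<in> I" "dist p0 p < e p0 / 2" using I(3) by auto
    have ep: "e p0 > 0" using e p0 I by blast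
    then have "p \<in> frontier G \<inter> ball p0 (e p0)" using p p0 by auto
    then obtain d where d: "norm d \<le> 1 / e p0"
      "\<forall>z\<in>G \<inter> ball p0 (e p0). d \<bullet> (z - p) + (norm (z - p))\<^sup>2 \<le> 0"
      using e p0(1) I(1) by blast
    have "1 / e p0 \<le> 1 / e0" using e0(1) e0_le[OF p0(1)] ep by (intro divide_left_mono) auto
    moreover have "z \<in> ball p0 (e p0)" if "z \<in> ball p e0" for z
      using that e0_le[OF p0(1)] p0(2) dist_triangle[of p0 z p] by simp
    ultimately show "\<exists>d. norm d \<le> 1 / e0 \<and>
       (\<forall>z\<in>G \<inter> ball p e0. d \<bullet> (z - p) + (norm (z - p))\<^sup>2 \<le> 0)"
      using d by (intro exI[of _ d]) auto
  qed (use e0 in simp)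
qed

section \<open>Derivatives of holomorphic discs\<close>

lemma holomorphic_discs_component:
  assumes "F \<in> holomorphic_discs G"
  shows "(\<lambda>w. F w $ j) holomorphic_on ball 0 1"
  using assms unfolding holomorphic_discs_def by blast

lemma holomorphic_discs_in:
  assumes "F \<in> holomorphic_discs G" "cmod w < 1"
  shows "F w \<in> G"
  using assms unfolding holomorphic_discs_def by auto

lemma holomorphic_discs_precompose:
  assumes "F \<in> holomorphic_discs G" "g holomorphic_on ball 0 1" "g ` ball 0 1 \<subseteq> ball 0 1"
  shows "(\<lambda>w. F (g w)) \<in> holomorphic_discs G"
  unfolding holomorphic_discs_def
proof (intro CollectI conjI allI)
  show "(\<lambda>w. F (g w) $ j) holomorphic_on ball 0 1" for j
    using holomorphic_on_compose_gen[OF assms(2) holomorphic_discs_component[OF assms(1), of j] assms(3)]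
    by (simp add: o_def)
  show "(\<lambda>w. F (g w)) ` ball 0 1 \<subseteq> G"
    using assms(1,3) unfolding holomorphic_discs_def by blast
qed

text \<open>Put \<open>F w $ j - F 0 $ j = w * h w\<close>. The maximum principle is applied to the real part of
  a complex linear function of \<open>F w - F 0\<close> plus \<open>\<tau>\<^sup>2 * u * (h w)\<^sup>2\<close> with
  \<open>cmod u \<le> 1\<close>: on the circle \<open>cmod w = \<tau>\<close> the last term is dominated by the quadratic
  term of the ball inequality, and at \<open>0\<close> it is \<open>\<tau>\<^sup>2\<close> times the squared derivative.\<close>

lemma disc_derivative_bound_in_touching_ball:
  fixes F :: "complex \<Rightarrow> complex ^ 'n"
  assumes F: "F \<in> holomorphic_discs G"
    and \<tau>: "0 < \<tau>" "\<tau> < 1"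
    and ball: "\<And>w. cmod w \<le> \<tau> \<Longrightarrow> d \<bullet> (F w - p) + (norm (F w - p))\<^sup>2 \<le> 0"
  shows "(\<tau> * cmod (deriv (\<lambda>w. F w $ j) 0))\<^sup>2 \<le> norm d * dist (F 0) p"
proof -
  define f where "f w = F w $ j" for w
  define a where "a = deriv f 0"
  define h where "h w = (if w = 0 then deriv f 0 else (f w - f 0) / (w - 0))" for w
  \<comment> \<open>Rotates \<open>a\<^sup>2\<close> to its modulus, so that the real part of
    \<open>\<Phi> 0\<close> is all of \<open>(\<tau> * cmod a)\<^sup>2\<close>.\<close>
  define u where "u = (cnj (sgn a))\<^sup>2"
  define q where "q = F 0"
  \<comment> \<open>Expanding the ball inequality about \<open>q\<close> instead of \<open>p\<close>
    adds \<open>2 *\<^sub>R (q - p)\<close> to the linear coefficient. \<open>L\<close> is the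
    complex linear functional whose real part is the inner product with \<open>d'\<close>.\<close>
  define d' where "d' = d + 2 *\<^sub>R (q - p)"
  define L where "L v = (\<Sum>k\<in>UNIV. cnj (d' $ k) * v $ k)" for v :: "complex ^ 'n"
  define \<Phi> where "\<Phi> w = L (F w - q) + of_real (\<tau>\<^sup>2) * u * (h w)\<^sup>2" for w
  have ReL: "Re (L v) = d' \<bullet> v" for v
    unfolding L_def by (simp add: inner_vec_def inner_complex_def)
  have "f holomorphic_on ball 0 1" unfolding f_def by (rule holomorphic_discs_component[OF F])
  then have holh: "h holomorphic_on ball 0 1"
    unfolding h_def[abs_def] by (rule pole_lemma_open) simp
  have hol\<Phi>: "\<Phi> holomorphic_on ball 0 1"
    unfolding \<Phi>_def[abs_def] L_def vector_minus_component
    by (intro holomorphic_intros holh holomorphic_discs_component[OF F])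
  have normu: "cmod u \<le> 1" unfolding u_def by (simp add: norm_power norm_sgn)
  have "cnj (sgn a) * a = of_real (cmod a)"
    by (cases "a = 0") (auto simp: sgn_eq complex_norm_square[symmetric] power2_eq_square field_simps)
  then have "u * a\<^sup>2 = of_real ((cmod a)\<^sup>2)"
    unfolding u_def by (metis of_real_power power_mult_distrib)
  then have \<Phi>0: "Re (\<Phi> 0) = (\<tau> * cmod a)\<^sup>2"
    unfolding \<Phi>_def h_def L_def q_def
    by (simp add: a_def[symmetric] mult.assoc power_mult_distrib flip: of_real_mult of_real_power)
  have bound: "Re (\<Phi> w) \<le> norm d * dist (F 0) p" if w: "cmod w = \<tau>" for w
  proof -
    define y where "y = F w - q"
    have "w \<noteq> 0" using w \<tau> by auto
    have "Re (of_real (\<tau>\<^sup>2) * u * (h w)\<^sup>2) \<le> cmod (of_real (\<tau>\<^sup>2) * u * (h w)\<^sup>2)"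
      by (rule complex_Re_le_cmod)
    also have "\<dots> = cmod u * (\<tau> * cmod (h w))\<^sup>2"
      by (simp add: norm_mult norm_power power_mult_distrib)
    also have "\<dots> \<le> 1 * (\<tau> * cmod (h w))\<^sup>2"
      by (intro mult_right_mono normu) auto
    also have "\<tau> * cmod (h w) = cmod (y $ j)"
      using \<open>w \<noteq> 0\<close> w \<tau>(1) unfolding h_def y_def q_def f_def by (simp add: norm_divide)
    also have "1 * (cmod (y $ j))\<^sup>2 \<le> (norm y)\<^sup>2"
      using Finite_Cartesian_Product.norm_nth_le[of y j] by (simp add: power_mono)
    finally have 1: "Re (\<Phi> w) \<le> d' \<bullet> y + (norm y)\<^sup>2" unfolding \<Phi>_def using ReL y_def by simp
    have "F w - p = y + (q - p)" unfolding y_def by simp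
    then have "d \<bullet> (F w - p) + (norm (F w - p))\<^sup>2
        = d' \<bullet> y + (norm y)\<^sup>2 + d \<bullet> (q - p) + (norm (q - p))\<^sup>2"
      unfolding d'_def by (simp add: power2_norm_eq_inner inner_simps inner_commute)
    then have "d' \<bullet> y + (norm y)\<^sup>2 \<le> - (d \<bullet> (q - p))"
      using ball[of w] w by (smt (verit) zero_le_power2)
    also have "\<dots> \<le> norm d * norm (q - p)"
      using norm_cauchy_schwarz[of "- d" "q - p"] by simp
    finally show ?thesis using 1 unfolding q_def dist_norm by simp
  qed
  have "Re (\<Phi> 0) \<le> norm d * dist (F 0) p"
  proof (rule maximum_real_frontier[of \<Phi> "ball 0 \<tau>"])
    show "\<Phi> holomorphic_on interior (ball 0 \<tau>)"
      using \<tau> by (auto intro: holomorphic_on_subset[OF hol\<Phi>])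
    show "continuous_on (closure (ball 0 \<tau>)) \<Phi>"
      using \<tau> by (intro continuous_on_subset[OF holomorphic_on_imp_continuous_on[OF hol\<Phi>]]) auto
    show "Re (\<Phi> z) \<le> norm d * dist (F 0) p" if "z \<in> frontier (ball 0 \<tau>)" for z
      using that \<tau> by (intro bound) (auto simp: frontier_def dist_norm)
  qed (use \<tau> in auto)
  then show ?thesis unfolding \<Phi>0 a_def f_def .
qed

text \<open>Division by \<open>M\<close> turns a component of \<open>F - F 0\<close> into a self-map
  of the unit disc fixing 0. These crude bounds limit how far a disc moves and settle the case of a
  centre far from \<open>p\<close>.\<close>

lemma disc_component_Schwarz:
  fixes F :: "complex \<Rightarrow> complex ^ 'n"
  assumes F: "F \<in> holomorphic_discs G" and M: "M > 0" "\<And>x y. \<lbrakk>x \<in> G; y \<in> G\<rbrakk> \<Longrightarrow> dist x y < M"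
  shows "cmod w < 1 \<Longrightarrow> cmod (F w $ j - F 0 $ j) \<le> M * cmod w"
    and "cmod (deriv (\<lambda>w. F w $ j) 0) \<le> M"
proof -
  define g where "g w = (F w $ j - F 0 $ j) / of_real M" for w
  note hol = holomorphic_discs_component[OF F, of j]
  have g: "g holomorphic_on ball 0 1" "g 0 = 0"
    unfolding g_def[abs_def] using M(1) by (auto intro!: holomorphic_intros hol)
  have g1: "cmod (g w) < 1" if "cmod w < 1" for w
  proof -
    have "cmod (F w $ j - F 0 $ j) \<le> dist (F w) (F 0)"
      using Finite_Cartesian_Product.norm_nth_le[of "F w - F 0" j] by (simp add: dist_norm)
    also have "\<dots> < M" using M(2) holomorphic_discs_in[OF F] that by simp
    finally show ?thesis unfolding g_def using M(1) by (simp add: norm_divide)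
  qed
  show "cmod (F w $ j - F 0 $ j) \<le> M * cmod w" if "cmod w < 1"
    using Schwarz_Lemma(1)[OF g g1 that] M(1) unfolding g_def
    by (simp add: norm_divide field_simps)
  have "(\<lambda>w. F w $ j) field_differentiable at 0"
    using hol by (simp add: holomorphic_on_imp_differentiable_at)
  then have "deriv g 0 = deriv (\<lambda>w. F w $ j) 0 / of_real M"
    unfolding g_def[abs_def] by (subst deriv_cdivide_right) (auto intro!: derivative_intros)
  then show "cmod (deriv (\<lambda>w. F w $ j) 0) \<le> M"
    using Schwarz_Lemma(2)[OF g g1, of 0] M(1) by (simp add: norm_divide pos_divide_le_eq)
qed

lemma disc_dist_le:
  fixes F :: "complex \<Rightarrow> complex ^ 'n"
  assumes F: "F \<in> holomorphic_discs G" and M: "M > 0" "\<And>x y. \<lbrakk>x \<in> G; y \<in> G\<rbrakk> \<Longrightarrow> dist x y < M"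
    and w: "cmod w < 1"
  shows "dist (F w) (F 0) \<le> real CARD('n) * M * cmod w"
proof -
  have "dist (F w) (F 0) \<le> (\<Sum>j\<in>UNIV. cmod ((F w - F 0) $ j))"
    unfolding dist_norm norm_vec_def by (rule L2_set_le_sum) auto
  also have "\<dots> \<le> (\<Sum>j\<in>(UNIV :: 'n set). M * cmod w)"
    using disc_component_Schwarz(1)[OF F M w] by (intro sum_mono) simp
  finally show ?thesis by simp
qed

text \<open>If \<open>F 0\<close> is within \<open>e / 2\<close> of \<open>p\<close>, then
  \<open>F\<close> stays, for \<open>cmod w \<le> \<tau>\<close>, where the ball touching at
  \<open>p\<close> contains the domain. Otherwise \<open>dist (F 0) p\<close> is at least
  \<open>e / 2\<close> and Schwarz's bound suffices. Uniformity in \<open>F\<close> is what allows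
  reparametrised discs later.\<close>

lemma disc_derivative_bound_at_0:
  fixes G :: "(complex ^ 'n) set"
  assumes G: "bounded_strongly_convex_domain G"
  shows "\<exists>C\<ge>0. \<forall>F\<in>holomorphic_discs G. \<forall>p\<in>frontier G. \<forall>j.
    (cmod (deriv (\<lambda>w. F w $ j) 0))\<^sup>2 \<le> C * dist (F 0) p"
proof -
  have "bounded G" using G unfolding bounded_strongly_convex_domain_def by blast
  define M where "M = diameter G + 1"
  have M: "M > 0" "\<And>x y. \<lbrakk>x \<in> G; y \<in> G\<rbrakk> \<Longrightarrow> dist x y < M"
    unfolding M_def using diameter_bounded_bound[OF \<open>bounded G\<close>] diameter_ge_0[OF \<open>bounded G\<close>]
    by (fastforce intro: add_nonneg_pos)+
  obtain e where e: "e > 0" and touch: "\<forall>p\<in>frontier G. \<exists>d. norm d \<le> 1 / e \<and>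
       (\<forall>z\<in>G \<inter> ball p e. d \<bullet> (z - p) + (norm (z - p))\<^sup>2 \<le> 0)"
    using bounded_strongly_convex_domain_uniform[OF G] by blast
  define n where "n = real CARD('n)"
  have n: "n > 0" unfolding n_def by simp
  \<comment> \<open>Small enough that \<open>F\<close> moves by at most \<open>e / 4\<close> on
    \<open>cmod w \<le> \<tau>\<close>.\<close>
  define \<tau> where "\<tau> = min (1 / 2) (e / (4 * n * M))"
  have \<tau>: "0 < \<tau>" "\<tau> < 1" unfolding \<tau>_def using e n M(1) by auto
  have "\<tau> \<le> e / (4 * n * M)" unfolding \<tau>_def by simp
  then have n\<tau>: "n * M * \<tau> \<le> e / 4" using n M(1) by (simp add: field_simps)
  define C where "C = max (1 / (e * \<tau>\<^sup>2)) (2 * M\<^sup>2 / e)"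
  have "C \<ge> 0" unfolding C_def using e by (simp add: le_max_iff_disj)
  have "(cmod (deriv (\<lambda>w. F w $ j) 0))\<^sup>2 \<le> C * dist (F 0) p"
    if F: "F \<in> holomorphic_discs G" and p: "p \<in> frontier G" for F p j
  proof (cases "dist (F 0) p < e / 2")
    case True
    obtain d where d: "norm d \<le> 1 / e"
      "\<forall>z\<in>G \<inter> ball p e. d \<bullet> (z - p) + (norm (z - p))\<^sup>2 \<le> 0"
      using touch p by blast
    have "d \<bullet> (F w - p) + (norm (F w - p))\<^sup>2 \<le> 0" if w: "cmod w \<le> \<tau>" for w
    proof -
      have w1: "cmod w < 1" using w \<tau> by simp
      have "dist (F w) (F 0) \<le> n * M * cmod w"
        using disc_dist_le[OF F M w1] unfolding n_def .
      also have "\<dots> \<le> n * M * \<tau>" using w n M(1) by (intro mult_left_mono) auto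
      finally have "dist (F w) p < e"
        using True n\<tau> e dist_triangle[of "F w" p "F 0"] by simp
      then show ?thesis
        using d(2) holomorphic_discs_in[OF F w1] by (simp add: dist_commute)
    qed
    then have "(\<tau> * cmod (deriv (\<lambda>w. F w $ j) 0))\<^sup>2 \<le> norm d * dist (F 0) p"
      by (intro disc_derivative_bound_in_touching_ball[OF F \<tau>])
    also have "\<dots> \<le> 1 / e * dist (F 0) p" by (intro mult_right_mono d) auto
    finally have "(cmod (deriv (\<lambda>w. F w $ j) 0))\<^sup>2 \<le> 1 / (e * \<tau>\<^sup>2) * dist (F 0) p"
      using \<tau>(1) e by (simp add: power_mult_distrib field_simps)
    also have "\<dots> \<le> C * dist (F 0) p" unfolding C_def by (intro mult_right_mono) auto
    finally show ?thesis .
  next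
    case False
    have "(cmod (deriv (\<lambda>w. F w $ j) 0))\<^sup>2 \<le> M\<^sup>2"
      using disc_component_Schwarz(2)[OF F M] by (intro power_mono) auto
    also have "\<dots> = 2 * M\<^sup>2 / e * (e / 2)" using e by simp
    also have "\<dots> \<le> C * dist (F 0) p"
      using False e \<open>C \<ge> 0\<close> by (intro mult_mono) (auto simp: C_def)
    finally show ?thesis .
  qed
  then show ?thesis using \<open>C \<ge> 0\<close> by blast
qed

text \<open>The affine map onto the disc about \<open>\<zeta>\<close> of radius
  \<open>1 - cmod \<zeta>\<close> sends 0 to \<open>\<zeta>\<close> and multiplies the derivative by
  that radius. Compared with a disc automorphism this loses at most a factor 2.\<close>

lemma disc_derivative_bound:
  fixes G :: "(complex ^ 'n) set"
  assumes G: "bounded_strongly_convex_domain G"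
  shows "\<exists>C\<ge>0. \<forall>F\<in>holomorphic_discs G. \<forall>p\<in>frontier G. \<forall>j. \<forall>\<zeta>\<in>ball 0 1.
    ((1 - cmod \<zeta>) * cmod (deriv (\<lambda>w. F w $ j) \<zeta>))\<^sup>2 \<le> C * dist (F \<zeta>) p"
proof -
  obtain C where "C \<ge> 0" and C: "\<forall>F\<in>holomorphic_discs G. \<forall>p\<in>frontier G. \<forall>j.
    (cmod (deriv (\<lambda>w. F w $ j) 0))\<^sup>2 \<le> C * dist (F 0) p"
    using disc_derivative_bound_at_0[OF G] by blast
  have "((1 - cmod \<zeta>) * cmod (deriv (\<lambda>w. F w $ j) \<zeta>))\<^sup>2 \<le> C * dist (F \<zeta>) p"
    if F: "F \<in> holomorphic_discs G" and p: "p \<in> frontier G" and \<zeta>: "\<zeta> \<in> ball 0 1" for F p j \<zeta>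
  proof -
    define g where "g w = \<zeta> + of_real (1 - cmod \<zeta>) * w" for w
    have "cmod (g w) < 1" if "cmod w < 1" for w
    proof -
      have "cmod (g w) \<le> cmod \<zeta> + (1 - cmod \<zeta>) * cmod w"
        unfolding g_def using \<zeta> norm_triangle_ineq[of \<zeta> "of_real (1 - cmod \<zeta>) * w"]
        by (simp add: norm_mult del: of_real_diff)
      also have "\<dots> < cmod \<zeta> + (1 - cmod \<zeta>) * 1"
        using \<zeta> that by (intro add_strict_left_mono mult_strict_left_mono) auto
      finally show ?thesis by simp
    qed
    then have "g ` ball 0 1 \<subseteq> ball 0 1" by auto
    moreover have "g holomorphic_on ball 0 1" unfolding g_def by (intro holomorphic_intros)
    ultimately have "(\<lambda>w. F (g w)) \<in> holomorphic_discs G"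
      by (intro holomorphic_discs_precompose[OF F])
    then have "(cmod (deriv (\<lambda>w. F (g w) $ j) 0))\<^sup>2 \<le> C * dist (F (g 0)) p"
      using bspec[OF bspec[OF C] p] by blast
    moreover have "deriv (\<lambda>w. F (g w) $ j) 0 = deriv (\<lambda>w. F w $ j) \<zeta> * of_real (1 - cmod \<zeta>)"
    proof -
      have "((\<lambda>w. F w $ j) has_field_derivative deriv (\<lambda>w. F w $ j) \<zeta>) (at (g 0))"
        using holomorphic_derivI[OF holomorphic_discs_component[OF F] open_ball \<zeta>]
        by (simp add: g_def)
      moreover have "(g has_field_derivative of_real (1 - cmod \<zeta>)) (at 0)"
        unfolding g_def by (auto intro!: derivative_eq_intros)
      ultimately show ?thesis
        using DERIV_chain[of "\<lambda>w. F w $ j" _ g 0] by (simp add: o_def DERIV_imp_deriv)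
    qed
    ultimately show ?thesis
      using \<zeta> by (simp add: norm_mult g_def mult.commute del: of_real_diff)
  qed
  then show ?thesis using \<open>C \<ge> 0\<close> by blast
qed

section \<open>Kobayashi distance\<close>

lemma artanh_real_mono:
  fixes x y :: real
  assumes "0 \<le> x" "x \<le> y" "y < 1"
  shows "artanh x \<le> artanh y"
proof -
  have "(1 + x) / (1 - x) \<le> (1 + y) / (1 - y)" using assms by (intro frac_le) auto
  moreover have "(1 + x) / (1 - x) > 0" "(1 + y) / (1 - y) > 0" using assms by auto
  ultimately show ?thesis unfolding artanh_def by simp
qed

lemma artanh_real_nonneg:
  fixes x :: real
  assumes "0 \<le> x" "x < 1"
  shows "0 \<le> artanh x"
  using artanh_real_mono[of 0 x] assms by (simp add: artanh_def)

text \<open>The quotient \<open>(1 + x) / (1 - x)\<close>, whose logarithm is twice artanh, is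
  multiplicative under this sum. The law turns the pseudohyperbolic triangle inequality into
  additivity of costs.\<close>

lemma artanh_add_real:
  fixes x y :: real
  assumes "0 \<le> x" "x < 1" "0 \<le> y" "y < 1"
  shows "artanh ((x + y) / (1 + x * y)) = artanh x + artanh y"
proof -
  have p: "1 + x * y > 0" using assms by (simp add: add_pos_nonneg)
  have "1 + (x + y) / (1 + x * y) = (1 + x) * (1 + y) / (1 + x * y)"
    using p by (simp add: field_simps)
  moreover have "1 - (x + y) / (1 + x * y) = (1 - x) * (1 - y) / (1 + x * y)"
    using p by (simp add: field_simps)
  ultimately have "(1 + (x + y) / (1 + x * y)) / (1 - (x + y) / (1 + x * y))
      = (1 + x) / (1 - x) * ((1 + y) / (1 - y))"
    using p by simp
  moreover have "ln ((1 + x) / (1 - x) * ((1 + y) / (1 - y)))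
      = ln ((1 + x) / (1 - x)) + ln ((1 + y) / (1 - y))"
    using assms by (intro ln_mult_pos) auto
  ultimately show ?thesis unfolding artanh_def by (simp add: add_divide_distrib)
qed

lemma poincare_dist_nonneg:
  assumes "cmod a < 1" "cmod b < 1"
  shows "poincare_dist a b \<ge> 0"
  unfolding poincare_dist_def
  using Moebius_function_norm_lt_1[OF assms(2,1), of 0]
  by (intro artanh_real_nonneg) (auto simp: Moebius_function_simple)

text \<open>Moebius maps carry \<open>a\<close> and \<open>f a\<close> to 0, where Schwarz's lemma
  applies.\<close>

lemma Schwarz_Pick:
  assumes hol: "f holomorphic_on ball 0 1" and f: "f ` ball 0 1 \<subseteq> ball 0 1"
    and a: "cmod a < 1" and b: "cmod b < 1"
  shows "cmod (Moebius_function 0 (f a) (f b)) \<le> cmod (Moebius_function 0 a b)"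
proof -
  have fa: "cmod (f w) < 1" if "cmod w < 1" for w using f that by force
  define g where "g = Moebius_function 0 (f a) \<circ> f \<circ> Moebius_function 0 (- a)"
  have "(Moebius_function 0 (- a)) ` ball 0 1 \<subseteq> ball 0 1"
    using Moebius_function_norm_lt_1[of "- a"] a by auto
  moreover have "Moebius_function 0 (- a) holomorphic_on ball 0 1"
    using Moebius_function_holomorphic[of "- a"] a by simp
  ultimately have "f \<circ> Moebius_function 0 (- a) holomorphic_on ball 0 1"
    using hol holomorphic_on_compose_gen by blast
  moreover have "(f \<circ> Moebius_function 0 (- a)) ` ball 0 1 \<subseteq> ball 0 1"
    using Moebius_function_norm_lt_1[of "- a"] a fa by auto
  ultimately have hg: "g holomorphic_on ball 0 1"
    unfolding g_def comp_assoc
    using Moebius_function_holomorphic[of "f a" 0] fa a holomorphic_on_compose_gen by blast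
  have g0: "g 0 = 0" unfolding g_def by (simp add: Moebius_function_of_zero Moebius_function_eq_zero)
  have g1: "cmod (g w) < 1" if "cmod w < 1" for w
    unfolding g_def using that a fa by (simp add: Moebius_function_norm_lt_1)
  have "cmod (g (Moebius_function 0 a b)) \<le> cmod (Moebius_function 0 a b)"
    by (rule Schwarz_Lemma(1)[OF hg g0 g1 Moebius_function_norm_lt_1[OF a b]])
  moreover have "Moebius_function 0 (- a) (Moebius_function 0 a b) = b"
    using Moebius_function_compose[of "- a" a b] a b by simp
  ultimately show ?thesis unfolding g_def by simp
qed

text \<open>Triangle inequality of the pseudohyperbolic distance along 0, \<open>a\<close>,
  \<open>b\<close>. With \<open>c\<close> the Moebius image of \<open>b\<close>,
  \<open>cmod b\<close> is the quotient of \<open>cmod (c + a)\<close> and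
  \<open>cmod (1 + cnj a * c)\<close>. After squaring and clearing denominators, the two sides
  differ by a nonnegative multiple of \<open>x * y - R\<close>.\<close>

lemma cmod_le_pseudohyperbolic_sum:
  assumes a: "cmod a < 1" and b: "cmod b < 1"
  defines "\<rho> \<equiv> cmod (Moebius_function 0 a b)"
  shows "cmod b \<le> (cmod a + \<rho>) / (1 + cmod a * \<rho>)"
proof -
  define c where "c = Moebius_function 0 a b"
  have c: "cmod c < 1" unfolding c_def by (rule Moebius_function_norm_lt_1[OF a b])
  define x y where "x = cmod a" and "y = cmod c"
  have xy: "0 \<le> x" "x < 1" "0 \<le> y" "y < 1" unfolding x_def y_def using a c by auto
  have p: "1 + x * y > 0" using xy by (simp add: add_pos_nonneg)
  have "b = Moebius_function 0 (- a) c"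
    unfolding c_def using Moebius_function_compose[of "- a" a b] a b by (simp only: norm_minus_cancel minus_minus)
  then have bc: "b = (c + a) / (1 + cnj a * c)" by (simp add: Moebius_function_simple)
  have ac: "cmod (cnj a * c) < 1"
    using norm_mult_less[of "cnj a" 1 c 1] a c by (simp only: complex_mod_cnj mult_1)
  have nz: "1 + cnj a * c \<noteq> 0"
  proof
    assume "1 + cnj a * c = 0"
    then have "cnj a * c = - 1" by (rule eq_neg_iff_add_eq_0[THEN iffD2, OF trans[OF add.commute]])
    then have "cmod (cnj a * c) = cmod (- 1)" by (rule arg_cong)
    with ac show False by (simp only: norm_minus_cancel norm_one less_irrefl)
  qed
  define R where "R = Re (cnj a * c)"
  have R: "R \<le> x * y"
    unfolding R_def x_def y_def using complex_Re_le_cmod[of "cnj a * c"] by (simp add: norm_mult)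
  have num: "(cmod (c + a))\<^sup>2 = x\<^sup>2 + y\<^sup>2 + 2 * R"
    unfolding x_def y_def R_def cmod_power2 by (simp add: power2_eq_square algebra_simps)
  have den: "(cmod (1 + cnj a * c))\<^sup>2 = 1 + 2 * R + (x * y)\<^sup>2"
    unfolding x_def y_def R_def power_mult_distrib cmod_power2
    by (simp add: power2_eq_square algebra_simps)
  have "(x\<^sup>2 + y\<^sup>2 + 2 * R) * (1 + x * y)\<^sup>2 \<le> (x + y)\<^sup>2 * (1 + 2 * R + (x * y)\<^sup>2)"
  proof -
    have "(x + y)\<^sup>2 * (1 + 2 * R + (x * y)\<^sup>2) - (x\<^sup>2 + y\<^sup>2 + 2 * R) * (1 + x * y)\<^sup>2
        = 2 * (x * y - R) * ((1 - x\<^sup>2) * (1 - y\<^sup>2))"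
      by (simp add: power2_eq_square algebra_simps)
    moreover have "x\<^sup>2 \<le> 1" "y\<^sup>2 \<le> 1" using xy by (simp_all add: power_le_one)
    then have "2 * (x * y - R) * ((1 - x\<^sup>2) * (1 - y\<^sup>2)) \<ge> 0"
      using R by (intro mult_nonneg_nonneg) auto
    ultimately show ?thesis by simp
  qed
  then have "(cmod (c + a) * (1 + x * y))\<^sup>2 \<le> ((x + y) * cmod (1 + cnj a * c))\<^sup>2"
    by (simp add: power_mult_distrib num den)
  then have "cmod (c + a) * (1 + x * y) \<le> (x + y) * cmod (1 + cnj a * c)"
    by (rule power2_le_imp_le) (use xy in simp)
  then have "cmod b \<le> (x + y) / (1 + x * y)"
    unfolding bc norm_divide pos_le_divide_eq[OF p] using nz
    by (simp add: pos_divide_le_eq)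
  then show ?thesis unfolding \<rho>_def x_def y_def c_def .
qed

text \<open>By Schwarz-Pick each link costs at least the distance between its end points, and the
  addition law for artanh sums these costs along any chain from 0.\<close>

lemma kobayashi_dist_unit_disc_ge:
  assumes \<zeta>: "cmod \<zeta> < 1"
  shows "artanh (cmod \<zeta>) \<le> kobayashi_dist_unit_disc 0 \<zeta>"
  unfolding kobayashi_dist_unit_disc_def kobayashi_dist_of_discs_def
proof (rule cInf_greatest, goal_cases)
  case 1
  \<comment> \<open>One link by the identity map: \<open>Inf\<close> is taken over a nonempty
    set.\<close>
  show ?case
    unfolding ex_in_conv[symmetric]
    by (rule exI[of _ "poincare_dist 0 \<zeta>"], rule CollectI, rule exI[of _ 1],
        rule exI[of _ "\<lambda>_ z. z"], rule exI[of _ "\<lambda>_. 0"], rule exI[of _ "\<lambda>_. \<zeta>"],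
        rule exI[of _ "\<lambda>i. if i = 0 then 0 else \<zeta>"]) (use \<zeta> in auto)
next
  case (2 x)
  then obtain m \<phi> a b p where x: "x = (\<Sum>i<m. poincare_dist (a i) (b i))"
    and p: "p 0 = 0" "p m = \<zeta>"
    and chain: "\<And>i. i < m \<Longrightarrow> \<phi> i holomorphic_on ball 0 1 \<and> \<phi> i ` ball 0 1 \<subseteq> ball 0 1 \<and>
      a i \<in> ball 0 1 \<and> b i \<in> ball 0 1 \<and> \<phi> i (a i) = p i \<and> \<phi> i (b i) = p (Suc i)"
    by blast
  have "cmod (p k) < 1 \<and> artanh (cmod (p k)) \<le> (\<Sum>i<k. poincare_dist (a i) (b i))" if "k \<le> m" for k
    using that
  proof (induction k)
    case 0
    then show ?case using p by (simp add: artanh_def)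
  next
    case (Suc k)
    note ch = chain[of k]
    have a: "cmod (a k) < 1" and b: "cmod (b k) < 1" and hol: "\<phi> k holomorphic_on ball 0 1"
      and img: "\<phi> k ` ball 0 1 \<subseteq> ball 0 1" and pk: "\<phi> k (a k) = p k" "\<phi> k (b k) = p (Suc k)"
      using ch Suc.prems by auto
    have pS: "cmod (p (Suc k)) < 1" and p0: "cmod (p k) < 1" using img a b pk by force+
    define \<rho> where "\<rho> = cmod (Moebius_function 0 (p k) (p (Suc k)))"
    define \<sigma> where "\<sigma> = cmod (Moebius_function 0 (b k) (a k))"
    have sym: "cmod (Moebius_function 0 (a k) (b k)) = \<sigma>"
    proof -
      have "cmod (1 - cnj (a k) * b k) = cmod (cnj (1 - cnj (a k) * b k))"
        by (simp only: complex_mod_cnj)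
      also have "\<dots> = cmod (1 - cnj (b k) * a k)" by (simp add: mult.commute)
      finally show ?thesis
        unfolding \<sigma>_def Moebius_function_simple by (simp add: norm_divide norm_minus_commute)
    qed
    have \<rho>\<sigma>: "0 \<le> \<rho>" "\<rho> \<le> \<sigma>" "\<rho> < 1" "\<sigma> < 1"
      using Schwarz_Pick[OF hol img a b] Moebius_function_norm_lt_1[OF b a]
        Moebius_function_norm_lt_1[OF p0 pS] pk sym unfolding \<rho>_def \<sigma>_def by auto
    have lt1: "(cmod (p k) + \<rho>) / (1 + cmod (p k) * \<rho>) < 1"
    proof -
      have "(1 - cmod (p k)) * (1 - \<rho>) > 0" using \<rho>\<sigma> p0 by simp
      moreover have "1 + cmod (p k) * \<rho> > 0" using \<rho>\<sigma> by (simp add: add_pos_nonneg)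
      ultimately show ?thesis by (simp add: field_simps)
    qed
    have "artanh (cmod (p (Suc k))) \<le> artanh ((cmod (p k) + \<rho>) / (1 + cmod (p k) * \<rho>))"
      using cmod_le_pseudohyperbolic_sum[OF p0 pS] lt1 unfolding \<rho>_def
      by (intro artanh_real_mono) auto
    also have "\<dots> = artanh (cmod (p k)) + artanh \<rho>"
      using p0 \<rho>\<sigma> by (intro artanh_add_real) auto
    also have "artanh \<rho> \<le> artanh \<sigma>" using \<rho>\<sigma> by (intro artanh_real_mono) auto
    also have "artanh \<sigma> = poincare_dist (a k) (b k)"
      unfolding \<sigma>_def poincare_dist_def Moebius_function_simple ..
    finally show ?case using pS Suc by simp
  qed
  from this[of m] show ?case using p x by simp
qed

section \<open>Upper bound for the Kobayashi distance of convex domains\<close>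

lemma norm_vector_scalar_mult:
  fixes c :: complex and v :: "complex ^ 'n"
  shows "norm (c *s v) = cmod c * norm v"
  unfolding norm_vec_def by (simp add: norm_mult L2_set_right_distrib)

text \<open>The affine disc centred at \<open>p i\<close> that reaches the next point at parameter
  1/2 lies in the ball of twice the step length. Every link therefore costs
  \<open>artanh (1 / 2)\<close>, whatever its length.\<close>

lemma kobayashi_dist_le_of_chain:
  fixes \<Omega> :: "(complex ^ 'n) set" and p :: "nat \<Rightarrow> complex ^ 'n"
  assumes "\<And>i. i < m \<Longrightarrow> p i \<in> \<Omega>"
    and ball: "\<And>i. i < m \<Longrightarrow> ball (p i) (2 * dist (p i) (p (Suc i))) \<subseteq> \<Omega>"
  shows "kobayashi_dist \<Omega> (p 0) (p m) \<le> real m * artanh (1 / 2)"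
  unfolding kobayashi_dist_def kobayashi_dist_of_discs_def
proof (rule cInf_lower, goal_cases)
  case 1
  define \<phi> where "\<phi> i w = (\<chi> j. p i $ j + 2 * w * (p (Suc i) - p i) $ j)" for i :: nat and w :: complex
  have "\<phi> i \<in> holomorphic_discs \<Omega>" if i: "i < m" for i
    unfolding holomorphic_discs_def
  proof (intro CollectI conjI allI subsetI)
    show "(\<lambda>w. \<phi> i w $ j) holomorphic_on ball 0 1" for j
      unfolding \<phi>_def vec_lambda_beta by (intro holomorphic_intros)
    fix z assume "z \<in> \<phi> i ` ball 0 1"
    then obtain w where w: "cmod w < 1" "z = \<phi> i w" by auto
    have "z - p i = (2 * w) *s (p (Suc i) - p i)"
      unfolding w(2) \<phi>_def by (simp add: vec_eq_iff right_diff_distrib)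
    then have "norm (z - p i) = cmod (2 * w) * norm (p (Suc i) - p i)"
      by (simp only: norm_vector_scalar_mult)
    then have "dist (p i) z = cmod w * (2 * dist (p i) (p (Suc i)))"
      by (simp add: dist_norm norm_minus_commute norm_mult)
    then show "z \<in> \<Omega>" 
    proof (cases "p i = p (Suc i)")
      \<comment> \<open>For a vanishing step the ball is empty, but the disc is constant with value
        \<open>p i\<close>.\<close>
      case True
      then show ?thesis using assms(1)[OF i] \<open>dist (p i) z = _\<close> by simp
    next
      case False
      then have "cmod w * (2 * dist (p i) (p (Suc i))) < 1 * (2 * dist (p i) (p (Suc i)))"
        using w by (intro mult_strict_right_mono) auto
      then have "z \<in> ball (p i) (2 * dist (p i) (p (Suc i)))"
        unfolding mem_ball \<open>dist (p i) z = _\<close> by simp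
      then show ?thesis by (rule subsetD[OF ball[OF i]])
    qed
  qed
  moreover have "\<phi> i 0 = p i" "\<phi> i (1 / 2) = p (Suc i)" for i
    unfolding \<phi>_def by (simp_all add: vec_eq_iff)
  ultimately have chain: "p 0 = p 0 \<and> p m = p m \<and>
      (\<forall>i<m. \<phi> i \<in> holomorphic_discs \<Omega> \<and> (0::complex) \<in> ball 0 1 \<and> (1 / 2::complex) \<in> ball 0 1 \<and>
        \<phi> i 0 = p i \<and> \<phi> i (1 / 2) = p (Suc i))"
    by (simp add: norm_divide)
  have sum: "real m * artanh (1 / 2) = (\<Sum>i<m. poincare_dist 0 (1 / 2))"
    unfolding poincare_dist_def by (simp add: norm_divide)
  show ?case
    by (rule CollectI, rule exI[of _ m], rule exI[of _ \<phi>], rule exI[of _ "\<lambda>_. 0"],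
        rule exI[of _ "\<lambda>_. 1 / 2"], rule exI[of _ p]) (rule conjI[OF sum chain])
next
  case 2
  show ?case
    by (rule bdd_belowI[of _ 0], elim CollectE exE conjE, hypsubst, intro sum_nonneg poincare_dist_nonneg) simp_all
qed

text \<open>The homothety with centre \<open>z\<close> and ratio \<open>t\<close> maps
  \<open>ball x \<rho>\<close> onto this ball, and convexity keeps the image in
  \<open>\<Omega>\<close>.\<close>

lemma ball_subset_convex_homothety:
  fixes \<Omega> :: "'a::real_normed_vector set"
  assumes "convex \<Omega>" "ball x \<rho> \<subseteq> \<Omega>" "z \<in> \<Omega>" and t: "0 < t" "t \<le> 1"
  shows "ball (x + (1 - t) *\<^sub>R (z - x)) (t * \<rho>) \<subseteq> \<Omega>"
proof
  fix y assume y: "y \<in> ball (x + (1 - t) *\<^sub>R (z - x)) (t * \<rho>)"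
  define v where "v = (y - (x + (1 - t) *\<^sub>R (z - x))) /\<^sub>R t"
  have "norm (y - (x + (1 - t) *\<^sub>R (z - x))) < t * \<rho>"
    using y by (simp add: dist_norm norm_minus_commute)
  moreover have "norm v = norm (y - (x + (1 - t) *\<^sub>R (z - x))) / t"
    unfolding v_def using t(1) by (simp only: norm_scaleR abs_inverse abs_of_pos divide_inverse mult.commute)
  ultimately have "norm v < \<rho>"
    using t(1) by (simp only: pos_divide_less_eq mult.commute)
  then have "x + v \<in> \<Omega>" using assms(2) by (auto simp: dist_norm)
  then have "(1 - t) *\<^sub>R z + t *\<^sub>R (x + v) \<in> \<Omega>"
    using convexD_alt[OF assms(1) assms(3), of "x + v" t] t by simp
  moreover have "y = x + (1 - t) *\<^sub>R (z - x) + t *\<^sub>R v"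
    unfolding v_def using t by simp
  then have "y = (1 - t) *\<^sub>R z + t *\<^sub>R (x + v)" by (simp add: algebra_simps)
  ultimately show "y \<in> \<Omega>" by simp
qed

text \<open>The chain of discs approaches \<open>z\<close> geometrically from \<open>x\<close>, so the number of its links is
  of the order of the logarithm of \<open>1 / \<delta>\<close>.\<close>

lemma kobayashi_dist_convex_le:
  fixes \<Omega> :: "(complex ^ 'n) set"
  assumes conv: "convex \<Omega>" and \<rho>: "ball x \<rho> \<subseteq> \<Omega>" "\<rho> > 0" and z: "z \<in> \<Omega>" "ball z \<delta> \<subseteq> \<Omega>"
    and M: "dist x z \<le> M" "M > 0" and q: "0 < q" "q < 1" "2 * (1 - q) * M \<le> \<rho>"
    and N: "3 * q ^ N * M \<le> \<delta>"
  shows "kobayashi_dist \<Omega> x z \<le> real (Suc N) * artanh (1 / 2)"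
proof -
  define p where "p i = (if i \<le> N then x + (1 - q ^ i) *\<^sub>R (z - x) else z)" for i
  have qi: "0 < q ^ i" "q ^ i \<le> 1" for i using q by (auto intro: power_le_one)
  have ball_p: "ball (p i) (q ^ i * \<rho>) \<subseteq> \<Omega>" if "i \<le> N" for i
    unfolding p_def using ball_subset_convex_homothety[OF conv \<rho>(1) z(1) qi, of i] that by simp
  have "p i \<in> \<Omega>" if "i < Suc N" for i
    using ball_p[of i] that qi(1)[of i] \<rho>(2) by (auto simp: subset_iff)
  moreover have "ball (p i) (2 * dist (p i) (p (Suc i))) \<subseteq> \<Omega>" if i: "i < Suc N" for i
  proof (cases "i = N")
    \<comment> \<open>The final jump to \<open>z\<close>: the ball about \<open>p N\<close> of twice
      the distance to \<open>z\<close> lies in the ball about \<open>z\<close> of three times that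
      distance, hence the 3 in the condition on \<open>N\<close>.\<close>
    case True
    have "p i - z = - (q ^ N) *\<^sub>R (z - x)" unfolding p_def True by (simp add: algebra_simps)
    then have "dist (p i) z = q ^ N * dist x z"
      using qi(1)[of N] by (simp add: dist_norm norm_minus_commute)
    also have "\<dots> \<le> q ^ N * M" using qi(1)[of N] M(1) by (intro mult_left_mono) auto
    finally have d: "dist (p i) z \<le> q ^ N * M" .
    have "ball (p i) (2 * dist (p i) z) \<subseteq> ball z \<delta>"
    proof
      fix y assume "y \<in> ball (p i) (2 * dist (p i) z)"
      then show "y \<in> ball z \<delta>"
        using dist_triangle[of z y "p i"] d N by (simp add: dist_commute)
    qed
    moreover have "p (Suc i) = z" unfolding p_def True by simp
    ultimately show ?thesis using z(2) by auto
  next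
    \<comment> \<open>Step length and available radius both scale with \<open>q ^ i\<close>, so one
      condition on \<open>q\<close> serves all these links.\<close>
    case False
    then have iN: "i \<le> N" "Suc i \<le> N" using i by auto
    have "p i - p (Suc i) = - (q ^ i * (1 - q)) *\<^sub>R (z - x)"
      unfolding p_def using iN by (simp add: algebra_simps)
    then have "dist (p i) (p (Suc i)) = q ^ i * (1 - q) * dist x z"
      using qi(1)[of i] q by (simp add: dist_norm norm_minus_commute abs_mult)
    also have "\<dots> \<le> q ^ i * (1 - q) * M" using qi(1)[of i] q M(1) by (intro mult_left_mono) auto
    finally have "2 * dist (p i) (p (Suc i)) \<le> 2 * (q ^ i * (1 - q) * M)" by simp
    also have "\<dots> = q ^ i * (2 * (1 - q) * M)" by simp
    also have "\<dots> \<le> q ^ i * \<rho>" using qi(1)[of i] q(3) by (intro mult_left_mono) auto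
    finally show ?thesis using ball_p[OF iN(1)] subset_ball by blast
  qed
  ultimately have "kobayashi_dist \<Omega> (p 0) (p (Suc N)) \<le> real (Suc N) * artanh (1 / 2)"
    by (intro kobayashi_dist_le_of_chain)
  then show ?thesis unfolding p_def by simp
qed

section \<open>Boundary distance along a complex geodesic\<close>

lemma artanh_half_pos: "artanh (1 / 2 :: real) > 0"
  by (simp add: artanh_def)

lemma one_minus_ge_exp_artanh:
  fixes x :: real
  assumes "0 \<le> x" "x < 1"
  shows "exp (- 2 * artanh x) \<le> 1 - x"
proof -
  have "exp (- 2 * artanh x) = inverse ((1 + x) / (1 - x))"
    unfolding artanh_def using assms by (simp add: exp_minus)
  also have "\<dots> = (1 - x) / (1 + x)" by simp
  also have "\<dots> \<le> (1 - x) / 1" using assms by (intro divide_left_mono) auto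
  finally show ?thesis by simp
qed

text \<open>The isometry puts \<open>artanh (cmod \<zeta>)\<close> below a multiple of
  \<open>Suc N\<close>, where \<open>q ^ N\<close> is comparable to the boundary distance.
  Exponentiating gives a power law.\<close>

lemma complex_geodesic_boundary_distance:
  fixes \<Omega> :: "(complex ^ 'n) set"
  assumes "open \<Omega>" "bounded \<Omega>" "convex \<Omega>" and geo: "complex_geodesic \<Omega> \<psi>"
  shows "\<exists>C\<ge>0. \<exists>\<beta>>0. \<forall>\<zeta>\<in>ball 0 1. infdist (\<psi> \<zeta>) (- \<Omega>) \<le> C * (1 - cmod \<zeta>) powr \<beta>"
proof -
  have \<psi>: "\<psi> \<in> holomorphic_discs \<Omega>" using geo unfolding complex_geodesic_def by blast
  have in\<Omega>: "\<psi> \<zeta> \<in> \<Omega>" if "cmod \<zeta> < 1" for \<zeta> using holomorphic_discs_in[OF \<psi> that] .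
  obtain \<rho> where \<rho>: "\<rho> > 0" "ball (\<psi> 0) \<rho> \<subseteq> \<Omega>"
    using openE[OF assms(1) in\<Omega>[of 0]] by auto
  obtain R where R: "\<And>y. y \<in> \<Omega> \<Longrightarrow> norm y \<le> R" using \<open>bounded \<Omega>\<close> unfolding bounded_iff by blast
  have "\<Omega> \<noteq> UNIV" using \<open>bounded \<Omega>\<close> not_bounded_UNIV by blast
  then obtain x where x: "x \<in> - \<Omega>" by blast
  \<comment> \<open>Dominates the boundary distance, through the outer point \<open>x\<close>, and
    the distance from \<open>\<psi> 0\<close> to any point of \<open>\<Omega>\<close>.\<close>
  define M where "M = R + norm x + norm (\<psi> 0) + 1"
  have "R \<ge> 0" using order_trans[OF norm_ge_zero R[OF in\<Omega>[of 0]]] by simp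
  then have M: "M > 0" unfolding M_def by (simp add: add_nonneg_pos)
  define q where "q = max (1 / 2) (1 - \<rho> / (2 * M))"
  have q: "0 < q" "q < 1" unfolding q_def using \<rho> M by auto
  have "1 - q \<le> \<rho> / (2 * M)" unfolding q_def by simp
  then have qM: "2 * (1 - q) * M \<le> \<rho>" using M by (simp add: field_simps)
  define K :: real where "K = artanh (1 / 2)"
  have K: "K > 0" unfolding K_def by (rule artanh_half_pos)
  \<comment> \<open>Chosen so that \<open>exp (- 2 * (real (Suc N) * K)) powr \<beta>\<close> is
    \<open>q ^ Suc N\<close>.\<close>
  define \<beta> where "\<beta> = - ln q / (2 * K)"
  have \<beta>: "\<beta> > 0" unfolding \<beta>_def by (intro divide_pos_pos) (use q K in auto)
  have main: "infdist (\<psi> \<zeta>) (- \<Omega>) \<le> 3 * M / q\<^sup>2 * (1 - cmod \<zeta>) powr \<beta>" if \<zeta>: "cmod \<zeta> < 1" for \<zeta>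
  proof -
    define z where "z = \<psi> \<zeta>"
    define \<delta> where "\<delta> = infdist z (- \<Omega>)"
    have z: "z \<in> \<Omega>" unfolding z_def by (rule in\<Omega>[OF \<zeta>])
    have "\<delta> > 0"
      unfolding \<delta>_def using z x \<open>open \<Omega>\<close> infdist_pos_not_in_closed[of "- \<Omega>" z] by auto
    have "\<delta> \<le> dist z x" unfolding \<delta>_def by (rule infdist_le[OF x])
    also have "\<dots> \<le> norm z + norm x" unfolding dist_norm by (rule norm_triangle_ineq4)
    also have "\<dots> \<le> M" unfolding M_def using R[OF z] norm_ge_zero[of "\<psi> 0"] by linarith
    also have "M < 3 * M" using M by simp
    finally have \<delta>M: "\<delta> < 3 * M" .
    have ball_z: "ball z \<delta> \<subseteq> \<Omega>"
    proof
      fix y assume "y \<in> ball z \<delta>"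
      then show "y \<in> \<Omega>" using infdist_le[of y "- \<Omega>" z] unfolding \<delta>_def by fastforce
    qed
    have dM: "dist (\<psi> 0) z \<le> M"
      using norm_triangle_ineq4[of "\<psi> 0" z] R[OF z] norm_ge_zero[of x] unfolding M_def dist_norm
      by linarith
    \<comment> \<open>Since the predecessor of the least \<open>N\<close> fails the condition,
      \<open>q ^ N\<close> is not much smaller than \<open>\<delta>\<close>. The predecessor exists
      because \<open>\<delta> < 3 * M\<close>.\<close>
    define N where "N = (LEAST n. 3 * q ^ n * M \<le> \<delta>)"
    obtain n where "q ^ n < \<delta> / (3 * M)"
      using real_arch_pow_inv[of "\<delta> / (3 * M)" q] q \<open>\<delta> > 0\<close> M by auto
    then have ex: "3 * q ^ n * M \<le> \<delta>" using M by (simp add: field_simps)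
    then have N: "3 * q ^ N * M \<le> \<delta>" unfolding N_def by (rule LeastI)
    have "N \<noteq> 0"
    proof
      assume "N = 0"
      with N \<delta>M show False by simp
    qed
    then obtain N' where N': "N = Suc N'" using not0_implies_Suc by blast
    have "\<delta> < 3 * q ^ N' * M"
      using not_less_Least[of N' "\<lambda>n. 3 * q ^ n * M \<le> \<delta>"] N' unfolding N_def by auto
    \<comment> \<open>\<open>Suc N\<close> exceeds \<open>N'\<close> by 2, hence the division by
      \<open>q\<^sup>2\<close>.\<close>
    then have \<delta>_le: "\<delta> \<le> 3 * M / q\<^sup>2 * q ^ Suc N"
      unfolding N' using q by (simp add: power2_eq_square field_simps)
    have "artanh (cmod \<zeta>) \<le> kobayashi_dist_unit_disc 0 \<zeta>"
      by (rule kobayashi_dist_unit_disc_ge[OF \<zeta>])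
    also have "\<dots> = kobayashi_dist \<Omega> (\<psi> 0) z"
      using geo \<zeta> unfolding complex_geodesic_def z_def by simp
    also have "\<dots> \<le> real (Suc N) * K"
      unfolding K_def by (rule kobayashi_dist_convex_le[OF assms(3) \<rho>(2,1) z ball_z dM M q qM N])
    finally have "exp (- 2 * (real (Suc N) * K)) \<le> exp (- 2 * artanh (cmod \<zeta>))" by simp
    also have "\<dots> \<le> 1 - cmod \<zeta>" using \<zeta> by (intro one_minus_ge_exp_artanh) auto
    finally have "exp (- 2 * (real (Suc N) * K)) powr \<beta> \<le> (1 - cmod \<zeta>) powr \<beta>"
      using \<beta> by (intro powr_mono2) auto
    moreover have "exp (- 2 * (real (Suc N) * K)) powr \<beta> = q ^ Suc N"
    proof -
      have "\<beta> * (- 2 * (real (Suc N) * K)) = real (Suc N) * ln q"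
        unfolding \<beta>_def using K by simp
      then show ?thesis
        using q(1) by (simp only: powr_def ln_exp exp_not_eq_zero if_False exp_of_nat_mult exp_ln)
    qed
    ultimately have "q ^ Suc N \<le> (1 - cmod \<zeta>) powr \<beta>" by simp
    then have "3 * M / q\<^sup>2 * q ^ Suc N \<le> 3 * M / q\<^sup>2 * (1 - cmod \<zeta>) powr \<beta>"
      using M by (intro mult_left_mono) auto
    then show ?thesis using \<delta>_le unfolding \<delta>_def z_def by linarith
  qed
  have "3 * M / q\<^sup>2 \<ge> 0" using M by simp
  with main \<beta> show ?thesis by (intro exI[of _ "3 * M / q\<^sup>2"] conjI exI[of _ \<beta>]) auto
qed

section \<open>Continuous extension\<close>

text \<open>The mean value inequality compares \<open>g\<close> along a radius with
  \<open>\<psi>\<close>, an antiderivative of the derivative bound. The resulting difference of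
  powers tends to 0 as \<open>s\<close> tends to 1, uniformly in \<open>z\<close>.\<close>

lemma radial_growth_bound:
  fixes g :: "complex \<Rightarrow> complex"
  assumes hol: "g holomorphic_on ball 0 1" and "\<alpha> > 0"
    and bd: "\<And>z. cmod z < 1 \<Longrightarrow> cmod (deriv g z) \<le> C * (1 - cmod z) powr (\<alpha> - 1)"
    and z: "cmod z < 1" and s: "0 < s" "s < 1"
  shows "cmod (g z - g (of_real s * z)) \<le> C / \<alpha> * ((1 - s * cmod z) powr \<alpha> - (1 - cmod z) powr \<alpha>)"
proof -
  define \<phi> where "\<phi> t = g (of_real t * z)" for t :: real
  define \<psi> where "\<psi> t = - (C / \<alpha>) * (1 - t * cmod z) powr \<alpha>" for t :: real
  have in_disc: "cmod (of_real t * z) < 1" and pos: "1 - t * cmod z > 0" and nrm: "cmod (of_real t * z) = t * cmod z"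
    if "t \<in> {s..1}" for t :: real
  proof -
    have "t * cmod z \<le> 1 * cmod z" using that by (intro mult_right_mono) auto
    then show "cmod (of_real t * z) < 1" "1 - t * cmod z > 0" "cmod (of_real t * z) = t * cmod z"
      using z that s by (auto simp: norm_mult)
  qed
  have d\<phi>: "(\<phi> has_vector_derivative z * deriv g (of_real t * z)) (at t)" if "t \<in> {s..1}" for t
  proof -
    have "(g has_field_derivative deriv g (of_real t * z)) (at (of_real t * z))"
      using in_disc[OF that] by (intro holomorphic_derivI[OF hol]) auto
    moreover have "((\<lambda>t. of_real t * z) has_vector_derivative z) (at t)"
      by (auto intro!: derivative_eq_intros)
    ultimately show ?thesis
      unfolding \<phi>_def using field_vector_diff_chain_at[of "\<lambda>t. of_real t * z" z t g] by (simp add: o_def)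
  qed
  have d\<psi>: "(\<psi> has_vector_derivative C * cmod z * (1 - t * cmod z) powr (\<alpha> - 1)) (at t)"
    if "t \<in> {s..1}" for t
  proof -
    have "((\<lambda>t. 1 - t * cmod z) has_real_derivative - cmod z) (at t)"
      by (auto intro!: derivative_eq_intros)
    from DERIV_cmult[OF DERIV_fun_powr[OF this pos[OF that], of \<alpha>], of "- (C / \<alpha>)"]
    have "(\<psi> has_real_derivative C * cmod z * (1 - t * cmod z) powr (\<alpha> - 1)) (at t)"
      unfolding \<psi>_def by (rule DERIV_cong) (use \<open>\<alpha> > 0\<close> in \<open>simp add: field_simps\<close>)
    then show ?thesis unfolding has_real_derivative_iff_has_vector_derivative .
  qed
  have "norm (\<phi> 1 - \<phi> s) \<le> \<psi> 1 - \<psi> s"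
  proof (rule differentiable_bound_general[OF s(2)])
    show "continuous_on {s..1} \<phi>" "continuous_on {s..1} \<psi>"
      using has_vector_derivative_continuous[OF d\<phi>] has_vector_derivative_continuous[OF d\<psi>]
      by (auto intro!: continuous_at_imp_continuous_on)
    show "(\<phi> has_vector_derivative z * deriv g (of_real t * z)) (at t)" if "s < t" "t < 1" for t
      using that by (intro d\<phi>) auto
    show "(\<psi> has_vector_derivative C * cmod z * (1 - t * cmod z) powr (\<alpha> - 1)) (at t)"
      if "s < t" "t < 1" for t
      using that by (intro d\<psi>) auto
    show "norm (z * deriv g (of_real t * z)) \<le> C * cmod z * (1 - t * cmod z) powr (\<alpha> - 1)"
      if "s < t" "t < 1" for t
    proof -
      have t: "t \<in> {s..1}" using that by auto
      have "cmod z * cmod (deriv g (of_real t * z)) \<le> cmod z * (C * (1 - t * cmod z) powr (\<alpha> - 1))"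
        using bd[OF in_disc[OF t]] unfolding nrm[OF t] by (intro mult_left_mono) auto
      then show ?thesis by (simp add: norm_mult algebra_simps)
    qed
  qed
  then show ?thesis unfolding \<phi>_def \<psi>_def by (simp add: algebra_simps)
qed

text \<open>The dilates \<open>g (of_real s * z)\<close> are uniformly continuous on the closed disc
  and, by the radial bound, uniformly close to \<open>g\<close> for \<open>s\<close> near 1. This
  gives continuity up to the circle without passing through a Hoelder estimate.\<close>

lemma Hardy_Littlewood_uniformly_continuous:
  fixes g :: "complex \<Rightarrow> complex"
  assumes hol: "g holomorphic_on ball 0 1" and "\<alpha> > 0"
    and bd: "\<And>z. cmod z < 1 \<Longrightarrow> cmod (deriv g z) \<le> C * (1 - cmod z) powr (\<alpha> - 1)"
  shows "uniformly_continuous_on (ball 0 1) g"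
  unfolding uniformly_continuous_on_def
proof (intro allI impI)
  fix e :: real assume "e > 0"
  have "0 \<le> cmod (deriv g 0)" by simp
  also have "\<dots> \<le> C" using bd[of 0] by simp
  finally have "C \<ge> 0" .
  define K where "K = C / \<alpha> + 1"
  have K: "K > 0" "C / \<alpha> \<le> K" unfolding K_def using \<open>C \<ge> 0\<close> \<open>\<alpha> > 0\<close> by (auto intro: add_nonneg_pos)
  \<comment> \<open>Uniform continuity treats all exponents alike; for \<open>\<alpha> < 1\<close>
    the power is not Lipschitz at 0.\<close>
  have "continuous_on {0..1} (\<lambda>x::real. x powr \<alpha>)"
    using \<open>\<alpha> > 0\<close> by (intro continuous_on_powr') (auto intro!: continuous_intros)
  then have "uniformly_continuous_on {0..1} (\<lambda>x::real. x powr \<alpha>)"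
    by (rule compact_uniformly_continuous) simp
  then obtain d where d: "d > 0" "\<And>x y. \<lbrakk>x \<in> {0..1}; y \<in> {0..1}; dist y x < d\<rbrakk>
      \<Longrightarrow> dist (y powr \<alpha>) (x powr \<alpha>) < e / 3 / K"
    unfolding uniformly_continuous_on_def using \<open>e > 0\<close> K(1) by (metis divide_pos_pos zero_less_numeral)
  define s where "s = max (1 / 2) (1 - d / 2)"
  have s: "0 < s" "s < 1" "1 - s < d" unfolding s_def using d(1) by auto
  have close: "cmod (g z - g (of_real s * z)) < e / 3" if z: "cmod z < 1" for z
  proof -
    have sz: "s * cmod z \<le> 1 * cmod z" using s by (intro mult_right_mono) auto
    have "(1 - s) * cmod z \<le> (1 - s) * 1" using z s by (intro mult_left_mono) auto
    then have "dist (1 - s * cmod z) (1 - cmod z) < d"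
      using sz s by (simp add: dist_real_def algebra_simps)
    moreover have "1 - s * cmod z \<in> {0..1}" "1 - cmod z \<in> {0..1}" using z sz s by auto
    ultimately have "dist ((1 - s * cmod z) powr \<alpha>) ((1 - cmod z) powr \<alpha>) < e / 3 / K"
      by (intro d(2))
    then have lt: "(1 - s * cmod z) powr \<alpha> - (1 - cmod z) powr \<alpha> < e / 3 / K"
      unfolding dist_real_def by linarith
    have nonneg: "(1 - s * cmod z) powr \<alpha> - (1 - cmod z) powr \<alpha> \<ge> 0"
      using sz z \<open>\<alpha> > 0\<close> by (simp add: powr_mono2)
    have "cmod (g z - g (of_real s * z)) \<le> C / \<alpha> * ((1 - s * cmod z) powr \<alpha> - (1 - cmod z) powr \<alpha>)"
      by (rule radial_growth_bound[OF hol \<open>\<alpha> > 0\<close> bd z s(1,2)])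
    also have "\<dots> \<le> K * ((1 - s * cmod z) powr \<alpha> - (1 - cmod z) powr \<alpha>)"
      using K nonneg by (intro mult_right_mono) auto
    also have "\<dots> < K * (e / 3 / K)"
      using K lt by (intro mult_strict_left_mono) auto
    also have "\<dots> = e / 3" using K by simp
    finally show ?thesis .
  qed
  have "continuous_on (cball 0 1) (\<lambda>z. g (of_real s * z))"
  proof (rule continuous_on_compose2[OF holomorphic_on_imp_continuous_on[OF hol]])
    show "(\<lambda>z. of_real s * z) ` cball 0 1 \<subseteq> ball (0::complex) 1"
    proof clarsimp
      fix z :: complex assume "cmod z \<le> 1"
      then have "s * cmod z \<le> s * 1" using s by (intro mult_left_mono) auto
      moreover have "cmod (of_real s * z) = s * cmod z" using s by (simp add: norm_mult)
      ultimately show "cmod (of_real s * z) < 1" using s by linarith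
    qed
  qed (intro continuous_intros)
  then have "uniformly_continuous_on (cball 0 1) (\<lambda>z. g (of_real s * z))"
    by (rule compact_uniformly_continuous) simp
  then obtain d' where d': "d' > 0" "\<And>x y. \<lbrakk>x \<in> cball 0 1; y \<in> cball 0 1; dist y x < d'\<rbrakk>
      \<Longrightarrow> dist (g (of_real s * y)) (g (of_real s * x)) < e / 3"
    unfolding uniformly_continuous_on_def using \<open>e > 0\<close> by (metis divide_pos_pos zero_less_numeral)
  have "dist (g y) (g x) < e" if xy: "x \<in> ball 0 1" "y \<in> ball 0 1" "dist y x < d'" for x y
  proof -
    have "dist (g (of_real s * y)) (g (of_real s * x)) < e / 3" using xy by (intro d'(2)) auto
    moreover have "dist (g y) (g (of_real s * y)) < e / 3" "dist (g x) (g (of_real s * x)) < e / 3"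
      using close xy by (simp_all add: dist_norm)
    ultimately show ?thesis
      using dist_triangle[of "g y" "g x" "g (of_real s * y)"]
        dist_triangle2[of "g (of_real s * y)" "g x" "g (of_real s * x)"] by linarith
  qed
  then show "\<exists>d>0. \<forall>x\<in>ball 0 1. \<forall>x'\<in>ball 0 1. dist x' x < d \<longrightarrow> dist (g x') (g x) < e"
    using d'(1) by blast
qed

section \<open>Finite intersections and the extension\<close>

lemma nearer_frontier_point:
  fixes G :: "'a::real_normed_vector set"
  assumes "z \<in> G" "p \<notin> G"
  obtains p' where "p' \<in> frontier G" "dist z p' \<le> dist z p"
proof -
  have "closed_segment z p \<inter> frontier G \<noteq> {}"
    using assms by (intro connected_Int_frontier) auto
  then obtain p' where "p' \<in> closed_segment z p" "p' \<in> frontier G" by blast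
  then show ?thesis using that segment_bound(1)[of p' z p] by (simp add: dist_norm norm_minus_commute)
qed

text \<open>A nearest point outside the intersection lies outside some member \<open>G\<close>, and
  a disc in the intersection is a disc in \<open>G\<close>, so the bound for \<open>G\<close>
  applies even at corners. The member varies with \<open>\<zeta>\<close>; the sum of the finitely
  many constants serves for all.\<close>

lemma intersection_disc_derivative_bound:
  fixes \<F> :: "(complex ^ 'n) set set"
  assumes fin: "finite \<F>" and G: "\<And>G. G \<in> \<F> \<Longrightarrow> bounded_strongly_convex_domain G"
    and ne: "\<Inter>\<F> \<noteq> UNIV"
  shows "\<exists>C\<ge>0. \<forall>F\<in>holomorphic_discs (\<Inter>\<F>). \<forall>j. \<forall>\<zeta>\<in>ball 0 1.
    ((1 - cmod \<zeta>) * cmod (deriv (\<lambda>w. F w $ j) \<zeta>))\<^sup>2 \<le> C * infdist (F \<zeta>) (- \<Inter>\<F>)"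
proof -
  obtain C where C: "\<And>G. G \<in> \<F> \<Longrightarrow> C G \<ge> 0 \<and> (\<forall>F\<in>holomorphic_discs G. \<forall>p\<in>frontier G. \<forall>j. \<forall>\<zeta>\<in>ball 0 1.
    ((1 - cmod \<zeta>) * cmod (deriv (\<lambda>w. F w $ j) \<zeta>))\<^sup>2 \<le> C G * dist (F \<zeta>) p)"
    using disc_derivative_bound[OF G] by metis
  have open\<Omega>: "open (\<Inter>\<F>)"
    using fin G unfolding bounded_strongly_convex_domain_def by (intro open_Inter) auto
  have "((1 - cmod \<zeta>) * cmod (deriv (\<lambda>w. F w $ j) \<zeta>))\<^sup>2 \<le> (\<Sum>G\<in>\<F>. C G) * infdist (F \<zeta>) (- \<Inter>\<F>)"
    if F: "F \<in> holomorphic_discs (\<Inter>\<F>)" and \<zeta>: "\<zeta> \<in> ball 0 1" for F j \<zeta>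
  proof -
    \<comment> \<open>A nonempty closed complement attains the distance; for the empty set
      \<open>infdist\<close> is 0 by convention.\<close>
    have "closed (- \<Inter>\<F>)" "- \<Inter>\<F> \<noteq> {}" using open\<Omega> ne by auto
    then obtain p where p: "p \<in> - \<Inter>\<F>" "infdist (F \<zeta>) (- \<Inter>\<F>) = dist (F \<zeta>) p"
      using infdist_attains_inf by blast
    then obtain G where GF: "G \<in> \<F>" "p \<notin> G" by blast
    have FG: "F \<in> holomorphic_discs G"
      using F GF(1) unfolding holomorphic_discs_def by blast
    have "F \<zeta> \<in> G" using holomorphic_discs_in[OF FG] \<zeta> by simp
    then obtain p' where p': "p' \<in> frontier G" "dist (F \<zeta>) p' \<le> dist (F \<zeta>) p"
      using nearer_frontier_point GF(2) by blast
    have "((1 - cmod \<zeta>) * cmod (deriv (\<lambda>w. F w $ j) \<zeta>))\<^sup>2 \<le> C G * dist (F \<zeta>) p'"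
      using C[OF GF(1)] FG p'(1) \<zeta> by blast
    also have "\<dots> \<le> (\<Sum>G\<in>\<F>. C G) * dist (F \<zeta>) p"
      using C p'(2) fin GF(1) by (intro mult_mono member_le_sum sum_nonneg) auto
    finally show ?thesis unfolding p(2) .
  qed
  moreover have "(\<Sum>G\<in>\<F>. C G) \<ge> 0" using C by (intro sum_nonneg) auto
  ultimately show ?thesis by blast
qed

theorem corollary1p10:
  fixes \<Omega> :: "(complex ^ 'n) set" and \<F> :: "(complex ^ 'n) set set"
    and \<psi> :: "complex \<Rightarrow> complex ^ 'n"
  assumes "finite \<F>" and "\<F> \<noteq> {}"
    and "\<And>G. G \<in> \<F> \<Longrightarrow> bounded_strongly_convex_domain G"
    and "\<Omega> = \<Inter>\<F>" and "\<Omega> \<noteq> {}"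
    and "complex_geodesic \<Omega> \<psi>"
  shows "\<exists>g. continuous_on (cball 0 1) g \<and> (\<forall>\<zeta> \<in> ball 0 1. g \<zeta> = \<psi> \<zeta>)"
proof -
  obtain G0 where G0: "G0 \<in> \<F>" using assms(2) by blast
  have opn: "open \<Omega>"
    using assms(1,3) unfolding assms(4) bounded_strongly_convex_domain_def by (intro open_Inter) auto
  have bnd: "bounded \<Omega>"
    using assms(3)[OF G0] bounded_subset[of G0 \<Omega>] G0
    unfolding assms(4) bounded_strongly_convex_domain_def by blast
  have cnv: "convex \<Omega>"
    unfolding assms(4) using assms(3) by (intro convex_Inter bounded_strongly_convex_domain_imp_convex)
  have "\<Inter>\<F> \<noteq> UNIV" using bnd not_bounded_UNIV unfolding assms(4) by metis
  then obtain C where C: "C \<ge> 0" "\<forall>F\<in>holomorphic_discs \<Omega>. \<forall>j. \<forall>\<zeta>\<in>ball 0 1.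
    ((1 - cmod \<zeta>) * cmod (deriv (\<lambda>w. F w $ j) \<zeta>))\<^sup>2 \<le> C * infdist (F \<zeta>) (- \<Omega>)"
    using intersection_disc_derivative_bound[OF assms(1,3)] unfolding assms(4) by blast
  obtain B \<beta> where B: "B \<ge> 0" "\<beta> > 0"
    "\<forall>\<zeta>\<in>ball 0 1. infdist (\<psi> \<zeta>) (- \<Omega>) \<le> B * (1 - cmod \<zeta>) powr \<beta>"
    using complex_geodesic_boundary_distance[OF opn bnd cnv assms(6)] by blast
  have \<psi>: "\<psi> \<in> holomorphic_discs \<Omega>" using assms(6) unfolding complex_geodesic_def by blast
  have "uniformly_continuous_on (ball 0 1) (\<lambda>\<zeta>. \<psi> \<zeta> $ j)" for j
  proof (rule Hardy_Littlewood_uniformly_continuous)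
    show "(\<lambda>\<zeta>. \<psi> \<zeta> $ j) holomorphic_on ball 0 1" by (rule holomorphic_discs_component[OF \<psi>])
    show "\<beta> / 2 > 0" using B(2) by simp
    fix \<zeta> :: complex assume \<zeta>: "cmod \<zeta> < 1"
    define t where "t = 1 - cmod \<zeta>"
    have t: "t > 0" unfolding t_def using \<zeta> by simp
    have "(t * cmod (deriv (\<lambda>w. \<psi> w $ j) \<zeta>))\<^sup>2 \<le> C * infdist (\<psi> \<zeta>) (- \<Omega>)"
      using C(2) \<psi> \<zeta> unfolding t_def by simp
    also have "\<dots> \<le> C * (B * t powr \<beta>)"
      using B(3) C(1) \<zeta> unfolding t_def by (intro mult_left_mono) auto
    \<comment> \<open>Taking the root halves the exponent; dividing by \<open>t\<close> then gives
      the Hardy-Littlewood hypothesis with exponent \<open>\<beta> / 2\<close>.\<close>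
    also have "\<dots> = (sqrt (C * B) * t powr (\<beta> / 2))\<^sup>2"
      using B(1) C(1) t by (simp add: power_mult_distrib powr_power)
    finally have "t * cmod (deriv (\<lambda>w. \<psi> w $ j) \<zeta>) \<le> sqrt (C * B) * t powr (\<beta> / 2)"
      by (rule power2_le_imp_le) (use B(1) C(1) in simp)
    then have "cmod (deriv (\<lambda>w. \<psi> w $ j) \<zeta>) \<le> sqrt (C * B) * (t powr (\<beta> / 2) / t)"
      using t by (simp add: field_simps)
    also have "t powr (\<beta> / 2) / t = t powr (\<beta> / 2 - 1)"
      using t by (simp add: powr_diff)
    finally show "cmod (deriv (\<lambda>w. \<psi> w $ j) \<zeta>) \<le> sqrt (C * B) * (1 - cmod \<zeta>) powr (\<beta> / 2 - 1)"
      unfolding t_def .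
  qed
  then have "\<exists>h. continuous_on (cball 0 1) h \<and> (\<forall>\<zeta>\<in>ball 0 1. h \<zeta> = \<psi> \<zeta> $ j)" for j
    using uniformly_continuous_on_extension_on_closure[of "ball 0 1" "\<lambda>\<zeta>. \<psi> \<zeta> $ j"]
    by (metis closure_ball uniformly_continuous_imp_continuous zero_less_one)
  then obtain h where h: "\<And>j. continuous_on (cball 0 1) (h j)" "\<And>j \<zeta>. \<zeta> \<in> ball 0 1 \<Longrightarrow> h j \<zeta> = \<psi> \<zeta> $ j"
    by metis
  show ?thesis
    by (rule exI[of _ "\<lambda>\<zeta>. \<chi> j. h j \<zeta>"])
      (use h in \<open>auto simp: vec_eq_iff intro: continuous_on_vec_lambda\<close>)
qed

end
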